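(* Let $n$ be a positive integer, let $N$ be an even integer with $N\geq n-1$, and let $r$ be an integer with $2\leq r\leq n$. Then \[ \sum_{b\in\mathcal{T}_{n}}t^{U_{1}(b)}u^{U_{r}(b)} =\operatorname{Pf}\begin{pmatrix} O_{n}&J_{n}B_{n}^{N}(t,u)\\ -{}^t\!B_{n}^{N}(t,u)J_{n}&\bar S_{n+N} \end{pmatrix}. \]
   Context: $\mathcal{T}_n$ denotes the set of triangular shifted arrays $b=(b_{ij})_{1\leq i\leq j\leq n-1}$ of integers whose entries are $\leq n$, weakly decreasing along rows and columns, and such that all entries in row $i$ are $\geq n-i$. With the conventions $b_{i,n}=n-i$ for all $i$ and $b_{0,j}=n$ for all $j$, for $r=1,\dots,n$ set $U_{r}(b)=\sum_{s=1}^{n-r}(b_{s,s+r-1}-b_{s,s+r})+\sum_{s=n-r+1}^{n-1}\chi\{b_{s,n-1}>n-s\}$, where $\chi\{P\}$ is $1$ if $P$ holds and $0$ otherwise. $O_n$ is the $n\times n$ zero matrix, $J_n=(\delta_{i,n+1-j})_{1\leq i,j\leq n}$, and $\bar S_{M}$ is the $M\times M$ skew-symmetric matrix with $(i,j)$ entry $(-1)^{j-i-1}$ for $i<j$. $B_{n}^{N}(t,u)=(b_{ij}(t,u))_{0\leq i\leq n-1,\,0\leq j\leq n+N-1}$ is the $n\times(n+N)$ matrix with $b_{0j}=\delta_{0,j}$, $b_{1j}=\delta_{0,j-1}+\delta_{0,j-2}\,tu$, and for $i\geq2$, $b_{ij}=\binom{i-2}{j-i}+\binom{i-2}{j-i-1}(t+u)+\binom{i-2}{j-i-2}tu$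 (binomials with negative lower index are $0$). $\operatorname{Pf}$ is the Pfaffian. *)

theory Defs
  imports "Jordan_Normal_Form.Determinant" "HOL-Library.FuncSet"
begin

definition triangle :: "nat \<Rightarrow> (nat \<times> nat) set" where
  "triangle n = {(i, j). 1 \<le> i \<and> i \<le> j \<and> j \<le> n - 1}"

(* Arrays are extensional functions on the triangle, so that each array is
   represented by exactly one function. *)
definition tri_arrays :: "nat \<Rightarrow> (nat \<times> nat \<Rightarrow> int) set" where
  "tri_arrays n = {b \<in> triangle n \<rightarrow>\<^sub>E UNIV.
     (\<forall>i j. (i, j) \<in> triangle n \<longrightarrow> int n - int i \<le> b (i, j) \<and> b (i, j) \<le> int n) \<and>
     (\<forall>i j k. (i, j) \<in> triangle n \<longrightarrow> (i, k) \<in> triangle n \<longrightarrow> j \<le> k \<longrightarrow> b (i, k) \<le> b (i, j)) \<and>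
     (\<forall>i k j. (i, j) \<in> triangle n \<longrightarrow> (k, j) \<in> triangle n \<longrightarrow> i \<le> k \<longrightarrow> b (k, j) \<le> b (i, j))}"

(* Row 0 and column n lie outside the triangle, where the values are fixed
   by convention. *)
definition ext :: "nat \<Rightarrow> (nat \<times> nat \<Rightarrow> int) \<Rightarrow> nat \<Rightarrow> nat \<Rightarrow> int" where
  "ext n b i j = (if i = 0 then int n else if j = n then int n - int i else b (i, j))"

definition U_stat :: "nat \<Rightarrow> nat \<Rightarrow> (nat \<times> nat \<Rightarrow> int) \<Rightarrow> int" where
  "U_stat n r b =
     (\<Sum>s = 1..n - r. ext n b s (s + r - 1) - ext n b s (s + r)) +
     (\<Sum>s = n - r + 1..n - 1. if ext n b s (n - 1) > int n - int s then 1 else 0)"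

definition binom :: "nat \<Rightarrow> int \<Rightarrow> 'a :: comm_ring_1" where
  "binom m k = (if k < 0 then 0 else of_nat (m choose nat k))"

definition B_mat :: "nat \<Rightarrow> nat \<Rightarrow> 'a \<Rightarrow> 'a \<Rightarrow> 'a :: comm_ring_1 mat" where
  "B_mat n N t u = mat n (n + N) (\<lambda>(i, j).
     if i = 0 then (if j = 0 then 1 else 0)
     else if i = 1 then (if j = 1 then 1 else 0) + (if j = 2 then 1 else 0) * (t * u)
     else binom (i - 2) (int j - int i)
        + binom (i - 2) (int j - int i - 1) * (t + u)
        + binom (i - 2) (int j - int i - 2) * (t * u))"

(* Matrix indices start at 0, so the condition i = n + 1 - j on 1-based
   indices becomes i + j + 1 = n. *)
definition J_mat :: "nat \<Rightarrow> 'a :: comm_ring_1 mat" where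
  "J_mat n = mat n n (\<lambda>(i, j). if i + j + 1 = n then 1 else 0)"

definition S_bar_mat :: "nat \<Rightarrow> 'a :: comm_ring_1 mat" where
  "S_bar_mat M = mat M M (\<lambda>(i, j).
     if i < j then (-1) ^ (j - i - 1) else if j < i then - ((-1) ^ (i - j - 1)) else 0)"

(* The sum runs over the perfect matchings of {0..<2m}. A matching
   {{p 0, p 1}, {p 2, p 3}, ...} is represented by the unique permutation p that lists
   each pair increasingly and the pairs in order of their first elements. *)
definition matching_perms :: "nat \<Rightarrow> (nat \<Rightarrow> nat) set" where
  "matching_perms m = {p. p permutes {0..<2 * m} \<and>
     (\<forall>k<m. p (2 * k) < p (2 * k + 1)) \<and>
     (\<forall>k. k + 1 < m \<longrightarrow> p (2 * k) < p (2 * (k + 1)))}"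

definition pfaffian :: "'a :: comm_ring_1 mat \<Rightarrow> 'a" where
  "pfaffian A = (if even (dim_row A)
     then \<Sum>p \<in> matching_perms (dim_row A div 2).
            signof p * (\<Prod>k<dim_row A div 2. A $$ (p (2 * k), p (2 * k + 1)))
     else 0)"

end

(* Both sides are sums over families of non-colliding particles. Writing the rows of B as the
   polynomials p_i = x^i prod_l (1 + w_l x), the Pfaffian on the right is an alternating multilinear
   form in the p_i that equals 1 on strictly increasing monomials. Expanding the factors label by
   label, every term in which two adjacent particles meet has two equal rows and vanishes, so
   the form becomes a weighted count of non-colliding families, made steps having weight w_l.
   The arrays b are encoded by the steps that are not made, i.e. by the same families for the
   reversed rows q_i = x^i prod_l (w_l + x). Now the normalized alternating form is also a Pfaffian of
   the pairing gram(f, g) = sum_{a < b} (f_a g_b - f_b g_a), and gram(p_i, p_j) = gram(q_i, q_j). *)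

theory Submission
  imports Defs
begin

text \<open>The block Pfaffian has no entry that pairs two rows of B, so exchanging p_i for q_i
  cannot be read off its entries; in the Gram Pfaffian the exchange is an identity of entries. The
  exchange rests on shift invariance, gram(x f, x g) = gram(f, g): a factor a + b x shared by both
  arguments then matters only through a^2 + b^2 and a b. For i >= 2 the row p_i is x^i (1 + t x)(1 +
  u x)(1 + x)^(i-2) wherever u is placed, which is why r is absent from the right side. The freedom
  to put u at label min r i comes from the particles: when i and i + 1 meet, only labels below i
  remain, and only there must neighbours have equal weights. Row 1 is exceptional because its single
  label carries both t and u. The bound N >= n - 1 makes room for the largest position 2 n - 2 among
  the n + N columns.\<close>

section \<open>Pfaffians\<close>

text \<open>The increasing enumeration of the indices other than \<open>0\<close> and \<open>Suc j\<close>.\<close>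
definition gap :: "nat \<Rightarrow> nat \<Rightarrow> nat" where
  "gap j x = (if x < j then Suc x else Suc (Suc x))"

text \<open>Expansion along the first row. Only entries above the diagonal are read, so a matrix may
  be replaced by any function agreeing with it there, even a symmetric one such as a
  constant.\<close>

primrec pf :: "nat \<Rightarrow> (nat \<Rightarrow> nat \<Rightarrow> 'a) \<Rightarrow> 'a :: comm_ring_1" where
  "pf 0 A = 1"
| "pf (Suc m) A =
     (\<Sum>j<2 * m + 1. (-1) ^ j * A 0 (Suc j) * pf m (\<lambda>x y. A (gap j x) (gap j y)))"

lemma gap_less_iff: "gap j x < gap j y \<longleftrightarrow> x < y"
  by (auto simp: gap_def)

lemma gap_bound: "x < n \<Longrightarrow> gap j x < n + 2"
  by (auto simp: gap_def)

lemma gap_neq_0 [simp]: "gap j x \<noteq> 0"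
  by (auto simp: gap_def)

lemma gap_neq [simp]: "gap j x \<noteq> Suc j"
  by (auto simp: gap_def)

lemma gap_inj: "gap j x = gap j y \<longleftrightarrow> x = y"
  by (auto simp: gap_def)

lemma gap_cases:
  assumes "y \<noteq> 0" "y \<noteq> Suc j" "y < n + 2" "j \<le> n"
  obtains x where "x < n" "gap j x = y"
proof (cases "y \<le> j")
  case True
  then have "y - 1 < n" "gap j (y - 1) = y" using assms by (auto simp: gap_def)
  then show ?thesis by (rule that)
next
  case False
  then have "y - 2 < n" "gap j (y - 2) = y" using assms by (auto simp: gap_def)
  then show ?thesis by (rule that)
qed

lemma gap_image: "j \<le> n \<Longrightarrow> gap j ` {..<n} = {..<n + 2} - {0, Suc j}"
proof (intro equalityI subsetI)
  fix y assume "j \<le> n" "y \<in> {..<n + 2} - {0, Suc j}"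
  then show "y \<in> gap j ` {..<n}"
    using gap_cases[of y j n "y \<in> gap j ` {..<n}"] by blast
qed (use gap_bound in fastforce)

lemma prod_gap:
  assumes "j \<le> n"
  shows "(\<Prod>z<n + 2. f z) = f 0 * f (Suc j) * (\<Prod>z<n. f (gap j z :: nat) :: 'a :: comm_monoid_mult)"
proof -
  have "(\<Prod>z<n. f (gap j z)) = (\<Prod>z\<in>{..<n + 2} - {0, Suc j}. f z)"
    unfolding gap_image[OF assms, symmetric]
    by (subst prod.reindex) (auto simp: inj_on_def gap_inj)
  moreover have "(\<Prod>z<n + 2. f z) = (\<Prod>z\<in>{0, Suc j}. f z) * (\<Prod>z\<in>{..<n + 2} - {0, Suc j}. f z)"
    using assms by (subst prod.subset_diff[of "{0, Suc j}"]) (auto simp: mult.commute)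
  ultimately show ?thesis by simp
qed

lemma pf_cong:
  assumes "\<And>x y. x < y \<Longrightarrow> y < 2 * m \<Longrightarrow> A x y = B x y"
  shows "pf m A = pf m B"
  using assms
proof (induction m arbitrary: A B)
  case (Suc m)
  have "pf m (\<lambda>x y. A (gap j x) (gap j y)) = pf m (\<lambda>x y. B (gap j x) (gap j y))" for j
  proof (rule Suc.IH)
    fix x y :: nat assume "x < y" "y < 2 * m"
    then show "A (gap j x) (gap j y) = B (gap j x) (gap j y)"
      using Suc.prems[of "gap j x" "gap j y"] gap_less_iff[of j x y] gap_bound[of y "2 * m" j] by simp
  qed
  moreover have "A 0 (Suc j) = B 0 (Suc j)" if "j < 2 * m + 1" for j
    using Suc.prems that by simp
  ultimately show ?case by (auto intro!: sum.cong)
qed simp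

lemma pf_linear:
  assumes "i < 2 * m"
    and "\<And>x y. x \<noteq> i \<Longrightarrow> y \<noteq> i \<Longrightarrow> A x y = P x y"
    and "\<And>x y. x \<noteq> i \<Longrightarrow> y \<noteq> i \<Longrightarrow> A x y = Q x y"
    and "\<And>y. y \<noteq> i \<Longrightarrow> A i y = a * P i y + b * Q i y"
    and "\<And>y. y \<noteq> i \<Longrightarrow> A y i = a * P y i + b * Q y i"
  shows "pf m A = a * pf m P + b * pf m Q"
  using assms
proof (induction m arbitrary: A P Q i)
  case (Suc m)
  have "(-1) ^ j * A 0 (Suc j) * pf m (\<lambda>x y. A (gap j x) (gap j y)) =
      a * ((-1) ^ j * P 0 (Suc j) * pf m (\<lambda>x y. P (gap j x) (gap j y))) +
      b * ((-1) ^ j * Q 0 (Suc j) * pf m (\<lambda>x y. Q (gap j x) (gap j y)))"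
    (is "?l j = a * ?p j + b * ?q j") if j: "j < 2 * m + 1" for j
  proof (cases "i = 0 \<or> i = Suc j")
    case True
    then have "gap j x \<noteq> i" for x by auto
    then have "pf m (\<lambda>x y. A (gap j x) (gap j y)) = pf m (\<lambda>x y. P (gap j x) (gap j y))"
      "pf m (\<lambda>x y. A (gap j x) (gap j y)) = pf m (\<lambda>x y. Q (gap j x) (gap j y))"
      using Suc.prems by (auto intro!: pf_cong)
    moreover have "A 0 (Suc j) = a * P 0 (Suc j) + b * Q 0 (Suc j)"
      using True Suc.prems by auto
    ultimately show ?thesis by (simp add: algebra_simps)
  next
    case False
    have bounds: "i < 2 * m + 2" "j \<le> 2 * m" using Suc.prems(1) j by auto
    from False obtain i' where i': "i' < 2 * m" "gap j i' = i"
      using gap_cases[OF _ _ bounds, of thesis] by blast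
    have "pf m (\<lambda>x y. A (gap j x) (gap j y)) =
      a * pf m (\<lambda>x y. P (gap j x) (gap j y)) + b * pf m (\<lambda>x y. Q (gap j x) (gap j y))"
      using i' Suc.prems by (intro Suc.IH[of i']) (auto simp: gap_inj)
    moreover have "A 0 (Suc j) = P 0 (Suc j)" "A 0 (Suc j) = Q 0 (Suc j)"
      using False Suc.prems by auto
    ultimately show ?thesis by (simp add: algebra_simps)
  qed
  then have "(\<Sum>j<2 * m + 1. ?l j) = (\<Sum>j<2 * m + 1. a * ?p j + b * ?q j)"
    by (auto intro!: sum.cong)
  then show ?case
    by (simp only: pf.simps sum.distrib sum_distrib_left)
qed simp

text \<open>Expanding a Pfaffian along two equal rows gives a double sum in which the pair of partners
  \<open>(Suc j, k)\<close> with \<open>k \<le> j\<close> is the swap of \<open>(k, j)\<close>. Pairing the terms, rather than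
  comparing the sum with its negative, keeps characteristic 2 admissible.\<close>
lemma sum_split_below_diagonal:
  fixes g :: "nat \<Rightarrow> nat \<Rightarrow> 'a :: comm_ring_1"
  assumes "\<And>j k. k \<le> j \<Longrightarrow> j < n \<Longrightarrow> g (Suc j) k = - g k j"
  shows "(\<Sum>j<Suc n. \<Sum>k<n. g j k) = 0"
proof -
  let ?lo = "{(j, k). j < Suc n \<and> k < j}" and ?hi = "{(j, k). j \<le> k \<and> k < n}"
  have lo: "g j k = - g k (j - 1)" if "k < j" "j < Suc n" for j k
    using assms[of k "j - 1"] that by (cases j) auto
  have fin: "finite ?lo" "finite ?hi"
    by (rule finite_subset[of _ "{..<Suc n} \<times> {..<Suc n}"]; auto)+
  have "(\<Sum>j<Suc n. \<Sum>k<n. g j k) = (\<Sum>(j, k)\<in>{..<Suc n} \<times> {..<n}. g j k)"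
    by (simp only: sum.cartesian_product)
  also have "{..<Suc n} \<times> {..<n} = ?lo \<union> ?hi" by auto
  also have "(\<Sum>(j, k)\<in>?lo \<union> ?hi. g j k) = (\<Sum>(j, k)\<in>?lo. g j k) + (\<Sum>(j, k)\<in>?hi. g j k)"
    by (rule sum.union_disjoint) (use fin in auto)
  also have "(\<Sum>(j, k)\<in>?lo. g j k) = (\<Sum>(j, k)\<in>?hi. - g j k)"
    by (rule sum.reindex_bij_witness[of _ "\<lambda>(k, j). (Suc j, k)" "\<lambda>(j, k). (k, j - 1)"])
       (use lo in auto)
  finally show ?thesis by (simp add: sum_negf split_def)
qed

text \<open>If both rows lie below row 0, a term of the expansion that keeps both vanishes by
  induction, and the two terms that remove one of them are negatives of each other. If row 0 is one
  of them, two expansions are needed: exchanging the partners of 0 and 1 flips the sign.\<close>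

lemma pf_equal_rows:
  assumes "Suc i < 2 * m" and "A i (Suc i) = 0"
    and "\<And>y. y \<noteq> i \<Longrightarrow> y \<noteq> Suc i \<Longrightarrow> A i y = A (Suc i) y"
    and "\<And>y. y \<noteq> i \<Longrightarrow> y \<noteq> Suc i \<Longrightarrow> A y i = A y (Suc i)"
  shows "pf m A = 0"
  using assms
proof (induction m arbitrary: A i)
  case (Suc m)
  let ?t = "\<lambda>j. (-1) ^ j * A 0 (Suc j) * pf m (\<lambda>x y. A (gap j x) (gap j y))"
  show ?case
  proof (cases i)
    case 0
    show ?thesis
    proof (cases m)
      case 0
      then show ?thesis using Suc.prems \<open>i = 0\<close> by simp
    next
      case (Suc l)
      \<comment> \<open>The term matching 0 with \<open>Suc (Suc j)\<close> and 1 with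
        \<open>gap (Suc j) (Suc k)\<close>. Removing the first pair turns row 1 into the first row
        of the minor, and its entries are read off row 0.\<close>
      define g where "g j k = (-1) ^ Suc (j + k) * A 0 (Suc (Suc j)) * A 0 (gap (Suc j) (Suc k)) *
        pf l (\<lambda>x y. A (gap (Suc j) (gap k x)) (gap (Suc j) (gap k y)))" for j k
      have "?t (Suc j) = (\<Sum>k<2 * l + 1. g j k)" for j
      proof -
        have "A (gap (Suc j) 0) (gap (Suc j) (Suc k)) = A 0 (gap (Suc j) (Suc k))" for k
          using Suc.prems(3)[of "gap (Suc j) (Suc k)"] \<open>i = 0\<close> by (simp add: gap_def)
        then show ?thesis
          unfolding Suc pf.simps g_def sum_distrib_left
          by (intro sum.cong) (auto simp: power_add algebra_simps)
      qed
      moreover have "?t 0 = 0" using Suc.prems \<open>i = 0\<close> by simp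
      moreover have "(\<Sum>j<2 * m + 1. ?t j) = ?t 0 + (\<Sum>j<2 * m. ?t (Suc j))"
        using sum.lessThan_Suc_shift[of ?t "2 * m"] by simp
      ultimately have "pf (Suc m) A = (\<Sum>j<2 * m. \<Sum>k<2 * l + 1. g j k)"
        by simp
      also have "2 * m = Suc (2 * l + 1)" using Suc by simp
      also have "(\<Sum>j<Suc (2 * l + 1). \<Sum>k<2 * l + 1. g j k) = 0"
      proof (rule sum_split_below_diagonal)
        fix j k :: nat assume "k \<le> j" "j < 2 * l + 1"
        have 1: "gap (Suc (Suc j)) (gap k x) = gap (Suc k) (gap j x)" for x
          using \<open>k \<le> j\<close> by (auto simp: gap_def)
        have 2: "gap (Suc (Suc j)) (Suc k) = Suc (Suc k)" "gap (Suc k) (Suc j) = Suc (Suc (Suc j))"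
          using \<open>k \<le> j\<close> by (auto simp: gap_def)
        show "g (Suc j) k = - g k j"
          unfolding g_def 1 2 by (simp add: algebra_simps)
      qed
      finally show ?thesis .
    qed
  next
    case (Suc k)
    have "?t j = 0" if "j < 2 * m + 1" "j \<noteq> k" "j \<noteq> Suc k" for j
    proof -
      \<comment> \<open>Position of \<open>i\<close> in the minor: removing 0 lowers it by one,
        removing \<open>Suc j\<close> by one more when \<open>Suc j < i\<close>.\<close>
      define i' where "i' = (if j < k then k - 1 else k)"
      have i': "gap j i' = i" "gap j (Suc i') = Suc i" "Suc i' < 2 * m"
        using that Suc Suc.prems(1) by (auto simp: gap_def i'_def)
      have "pf m (\<lambda>x y. A (gap j x) (gap j y)) = 0"
      proof (rule Suc.IH[of i'])
        fix y :: nat assume "y \<noteq> i'" "y \<noteq> Suc i'"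
        then have "gap j y \<noteq> i" "gap j y \<noteq> Suc i"
          using gap_inj[of j y i'] gap_inj[of j y "Suc i'"] i' by auto
        then show "A (gap j i') (gap j y) = A (gap j (Suc i')) (gap j y)"
            "A (gap j y) (gap j i') = A (gap j y) (gap j (Suc i'))"
          using Suc.prems i' by auto
      qed (use i' Suc.prems in auto)
      then show ?thesis by simp
    qed
    then have "(\<Sum>j<2 * m + 1. ?t j) = (\<Sum>j\<in>{k, Suc k}. ?t j)"
      using Suc.prems(1) Suc by (intro sum.mono_neutral_right) auto
    also have "\<dots> = ?t k + ?t (Suc k)" by simp
    also have "?t (Suc k) = - ?t k"
    proof -
      have "pf m (\<lambda>x y. A (gap (Suc k) x) (gap (Suc k) y)) = pf m (\<lambda>x y. A (gap k x) (gap k y))"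
      proof (rule pf_cong)
        have e: "gap (Suc k) x = gap k x" if "x \<noteq> k" for x
          using that by (auto simp: gap_def)
        have e': "gap (Suc k) k = i" "gap k k = Suc i" using Suc by (auto simp: gap_def)
        fix x y :: nat assume "x < y"
        then consider "x = k" "y \<noteq> k" | "x \<noteq> k" "y = k" | "x \<noteq> k" "y \<noteq> k" by linarith
        then show "A (gap (Suc k) x) (gap (Suc k) y) = A (gap k x) (gap k y)"
        proof cases
          case 1
          then have "gap k y \<noteq> i" "gap k y \<noteq> Suc i" using Suc by (auto simp: gap_def)
          then show ?thesis using 1 e e' Suc.prems(3) by simp
        next
          case 2
          then have "gap k x \<noteq> i" "gap k x \<noteq> Suc i" using Suc by (auto simp: gap_def)
          then show ?thesis using 2 e e' Suc.prems(4) by simp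
        qed (simp add: e)
      qed
      moreover have "A 0 (Suc (Suc k)) = A 0 (Suc k)"
        using Suc.prems(4)[of 0] Suc by simp
      ultimately show ?thesis by simp
    qed
    finally show ?thesis by simp
  qed
qed simp

lemma pf_scale:
  "pf m (\<lambda>x y. \<sigma> x * \<sigma> y * A x y) = (\<Prod>z<2 * m. \<sigma> z) * pf m A"
proof (induction m arbitrary: \<sigma> A)
  case (Suc m)
  have "(-1) ^ j * (\<sigma> 0 * \<sigma> (Suc j) * A 0 (Suc j)) *
      pf m (\<lambda>x y. \<sigma> (gap j x) * \<sigma> (gap j y) * A (gap j x) (gap j y)) =
      (\<Prod>z<2 * Suc m. \<sigma> z) * ((-1) ^ j * A 0 (Suc j) * pf m (\<lambda>x y. A (gap j x) (gap j y)))"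
    if "j < 2 * m + 1" for j
    using that prod_gap[of j "2 * m" \<sigma>]
      Suc.IH[of "\<lambda>x. \<sigma> (gap j x)" "\<lambda>x y. A (gap j x) (gap j y)"]
    by (simp add: algebra_simps)
  then show ?case
    by (simp only: pf.simps sum_distrib_left) (auto intro!: sum.cong)
qed simp

lemma alternating_sum_odd: "(\<Sum>j<2 * m + 1. (-1) ^ j) = (1 :: 'a :: ring_1)"
  by (induction m) auto

lemma pf_const: "pf m (\<lambda>x y. c) = c ^ m"
proof (induction m)
  case (Suc m)
  have "pf (Suc m) (\<lambda>x y. c) = (\<Sum>j<2 * m + 1. (-1) ^ j) * (c * c ^ m)"
    unfolding pf.simps Suc sum_distrib_right by (simp only: mult.assoc)
  then show ?case by (simp only: alternating_sum_odd power_Suc mult_1)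
qed simp

section \<open>Perfect matchings built up from the pair containing 0\<close>

definition lift_matching :: "nat \<Rightarrow> (nat \<Rightarrow> nat) \<Rightarrow> nat \<Rightarrow> nat" where
  "lift_matching j q = permutation_insert 0 0 (permutation_insert 0 j q)"

lemma lift_matching_simps [simp]:
  "lift_matching j q 0 = 0"
  "lift_matching j q (Suc 0) = Suc j"
  "lift_matching j q (Suc (Suc x)) = gap j (q x)"
  "lift_matching j q 2 = gap j (q 0)"
  by (auto simp: lift_matching_def permutation_insert_expand gap_def)

lemma lift_matching_permutes:
  assumes "q permutes {0..<2 * m}" and "j < 2 * m + 1"
  shows "lift_matching j q permutes {0..<2 * Suc m}"
  using permutation_insert_permutes[OF permutation_insert_permutes[OF assms(1), of 0 j], of 0 0] assms(2)
  by (simp add: lift_matching_def)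

text \<open>The inner insertion puts the value \<open>j\<close> in front, with sign
  \<open>(-1) ^ j\<close>; the outer one puts 0 before it, with sign 1, and raises \<open>j\<close>
  to \<open>Suc j\<close>.\<close>

lemma signof_lift_matching:
  assumes "q permutes {0..<2 * m}" and "j < 2 * m + 1"
  shows "(signof (lift_matching j q) :: 'a :: ring_1) = (-1) ^ j * signof q"
  using signof_permutation_insert[OF permutation_insert_permutes[OF assms(1), of 0 j], of 0 0, where 'a = 'a]
    signof_permutation_insert[OF assms(1), of 0 j, where 'a = 'a] assms(2)
  by (simp add: lift_matching_def)

lemma matching_perms_0: "p 0 = 0" if "p \<in> matching_perms (Suc m)"
proof -
  have p: "p permutes {0..<2 * Suc m}" "\<And>k. k < Suc m \<Longrightarrow> p (2 * k) < p (2 * k + 1)"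
    "\<And>k. k + 1 < Suc m \<Longrightarrow> p (2 * k) < p (2 * (k + 1))"
    using that by (auto simp: matching_perms_def)
  have "0 \<in> p ` {0..<2 * Suc m}" using permutes_image[OF p(1)] by simp
  then obtain x where x: "x < 2 * Suc m" "p x = 0" by auto
  show ?thesis
  proof (cases "even x")
    case True
    then obtain k where k: "x = 2 * k" by blast
    show ?thesis
    proof (cases k)
      case (Suc l)
      then show ?thesis using p(3)[of l] x k by simp
    qed (use x k in simp)
  next
    case False
    then obtain k where "x = 2 * k + 1" by (elim oddE)
    then show ?thesis using p(2)[of k] x by simp
  qed
qed

lemma matching_perms_Suc:
  "matching_perms (Suc m) = (\<lambda>(j, q). lift_matching j q) ` ({..<2 * m + 1} \<times> matching_perms m)"
proof (intro equalityI subsetI)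
  fix p assume p: "p \<in> matching_perms (Suc m)"
  then have "p permutes {0..<Suc (2 * m + 1)}" "p 0 = 0"
    using matching_perms_0 by (auto simp: matching_perms_def)
  then have "p \<in> permutation_insert 0 0 ` {q. q permutes {0..<2 * m + 1}}"
    using permutation_fix[of 0 "2 * m + 1" 0] by blast
  then obtain q1 where q1: "q1 permutes {0..<Suc (2 * m)}" "p = permutation_insert 0 0 q1"
    by auto
  define j where "j = q1 0"
  have j: "j < 2 * m + 1" using permutes_in_image[OF q1(1), of 0] by (simp add: j_def)
  then have "q1 \<in> permutation_insert 0 j ` {q. q permutes {0..<2 * m}}"
    using permutation_fix[of 0 "2 * m" j] q1 j_def by auto
  then obtain q where q: "q permutes {0..<2 * m}" "q1 = permutation_insert 0 j q" by auto
  have pq: "p = lift_matching j q" using q q1 by (simp add: lift_matching_def)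
  have "q (2 * k) < q (2 * k + 1)" if "k < m" for k
  proof -
    have "p (2 * Suc k) < p (2 * Suc k + 1)"
      using p that unfolding matching_perms_def by (auto simp del: mult_Suc_right)
    then show ?thesis by (simp add: pq gap_less_iff)
  qed
  moreover have "q (2 * k) < q (2 * (k + 1))" if "k + 1 < m" for k
  proof -
    have "p (2 * Suc k) < p (2 * (Suc k + 1))"
      using p that unfolding matching_perms_def by (auto simp del: mult_Suc_right)
    then show ?thesis by (simp add: pq gap_less_iff)
  qed
  ultimately have "q \<in> matching_perms m" using q by (simp add: matching_perms_def)
  then show "p \<in> (\<lambda>(j, q). lift_matching j q) ` ({..<2 * m + 1} \<times> matching_perms m)"
    using pq j by auto
next
  fix p assume "p \<in> (\<lambda>(j, q). lift_matching j q) ` ({..<2 * m + 1} \<times> matching_perms m)"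
  then obtain j q where jq: "j < 2 * m + 1" "q \<in> matching_perms m" "p = lift_matching j q"
    by auto
  have "p (2 * k) < p (2 * k + 1)" if "k < Suc m" for k
    using that jq by (cases k) (auto simp: matching_perms_def gap_less_iff)
  moreover have "p (2 * k) < p (2 * (k + 1))" if "k + 1 < Suc m" for k
    using that jq by (cases k) (auto simp: matching_perms_def gap_less_iff simp flip: neq0_conv)
  moreover have "p permutes {0..<2 * Suc m}"
    using jq lift_matching_permutes[of q m j] by (simp add: matching_perms_def)
  ultimately show "p \<in> matching_perms (Suc m)" by (simp add: matching_perms_def)
qed

lemma inj_lift_matching: "lift_matching j q = lift_matching j' q' \<longleftrightarrow> j = j' \<and> q = q'"
proof
  assume eq: "lift_matching j q = lift_matching j' q'"
  have "j = j'" using fun_cong[OF eq, of "Suc 0"] by simp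
  moreover have "q x = q' x" for x
    using fun_cong[OF eq, of "Suc (Suc x)"] \<open>j = j'\<close> by (simp add: gap_inj)
  ultimately show "j = j' \<and> q = q'" by auto
qed simp

text \<open>The first pair of every matching contains 0, and its partner \<open>Suc j\<close> is the
  summation variable of the recursion for \<open>pf\<close>.\<close>

lemma matching_sum_eq_pf:
  "(\<Sum>p\<in>matching_perms m. signof p * (\<Prod>k<m. A (p (2 * k)) (p (2 * k + 1)))) = pf m A"
proof (induction m arbitrary: A)
  case 0
  have "matching_perms 0 = {id}" by (auto simp: matching_perms_def)
  then show ?case by (simp add: sign_id)
next
  case (Suc m)
  let ?f = "\<lambda>A m p. signof p * (\<Prod>k<m. A (p (2 * k)) (p (2 * k + 1)))"
  have "(\<Sum>p\<in>matching_perms (Suc m). ?f A (Suc m) p) =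
      (\<Sum>(j, q)\<in>{..<2 * m + 1} \<times> matching_perms m. ?f A (Suc m) (lift_matching j q))"
    unfolding matching_perms_Suc
    by (subst sum.reindex) (auto simp: inj_on_def inj_lift_matching split_def)
  also have "\<dots> = (\<Sum>j<2 * m + 1. \<Sum>q\<in>matching_perms m. ?f A (Suc m) (lift_matching j q))"
    by (simp only: sum.cartesian_product)
  also have "\<dots> = (\<Sum>j<2 * m + 1. \<Sum>q\<in>matching_perms m.
      (-1) ^ j * A 0 (Suc j) * ?f (\<lambda>x y. A (gap j x) (gap j y)) m q)"
  proof (intro sum.cong refl)
    fix j q assume "j \<in> {..<2 * m + 1}" "q \<in> matching_perms m"
    then have "signof (lift_matching j q) = (-1) ^ j * (signof q :: 'a)"
      by (intro signof_lift_matching[of q m]) (auto simp: matching_perms_def)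
    then show "?f A (Suc m) (lift_matching j q) =
        (-1) ^ j * A 0 (Suc j) * ?f (\<lambda>x y. A (gap j x) (gap j y)) m q"
      by (simp add: prod.lessThan_Suc_shift algebra_simps del: prod.lessThan_Suc)
  qed
  also have "\<dots> = pf (Suc m) A"
    unfolding pf.simps sum_distrib_left[symmetric]
    using Suc.IH[of "\<lambda>x y. A (gap j x) (gap j y)" for j] by simp
  finally show ?case .
qed

lemma pfaffian_eq_pf:
  assumes "dim_row M = 2 * m"
  shows "pfaffian M = pf m (\<lambda>i j. M $$ (i, j))"
  using assms matching_sum_eq_pf[where A = "\<lambda>i j. M $$ (i, j)" and m = m] by (simp add: pfaffian_def)

section \<open>Alternating forms and non-colliding particles\<close>

text \<open>Particle \<open>i < n\<close> starts at position \<open>i\<close> and makes one optional unit step for each label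
  \<open>l = i, \<dots>, 1\<close>, in decreasing order of labels. A pair \<open>(i, l) \<in> E\<close> means that the step is made,
  and the inequality in \<open>path_families\<close> says that the positions
  \<open>i + steps_above E l i\<close> stay strictly increasing in \<open>i\<close>.\<close>
definition tri_labels :: "nat \<Rightarrow> nat \<Rightarrow> (nat \<times> nat) set" where
  "tri_labels n k = {(i, l). k < l \<and> l \<le> i \<and> i < n}"

definition steps_above :: "(nat \<times> nat) set \<Rightarrow> nat \<Rightarrow> nat \<Rightarrow> nat" where
  "steps_above E k i = card {l. k < l \<and> (i, l) \<in> E}"

definition path_families :: "nat \<Rightarrow> nat \<Rightarrow> (nat \<times> nat) set set" where
  "path_families n k = {E. E \<subseteq> tri_labels n k \<and>
     (\<forall>l i. k \<le> l \<longrightarrow> l \<le> i \<longrightarrow> Suc i < n \<longrightarrow> steps_above E l i \<le> steps_above E l (Suc i))}"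

lemma finite_tri_labels [simp]: "finite (tri_labels n k)"
  by (rule finite_subset[of _ "{..<n} \<times> {..<n}"]) (auto simp: tri_labels_def)

lemma finite_path_families [simp]: "finite (path_families n k)"
  by (rule finite_subset[of _ "Pow (tri_labels n k)"]) (auto simp: path_families_def)

lemma tri_labels_step:
  "tri_labels n k = tri_labels n (Suc k) \<union> {Suc k..<n} \<times> {Suc k}"
  by (auto simp: tri_labels_def)

lemma finite_steps:
  "E \<subseteq> tri_labels n 0 \<Longrightarrow> finite {l. k < l \<and> (i, l) \<in> E}"
  by (rule finite_subset[of _ "{..i}"]) (auto simp: tri_labels_def)

lemma tri_labels_mono: "E \<subseteq> tri_labels n k \<Longrightarrow> E \<subseteq> tri_labels n 0"
  by (auto simp: tri_labels_def)

lemma steps_above_le: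
  assumes "E \<subseteq> tri_labels n 0"
  shows "steps_above E k i \<le> i - k"
proof -
  have "steps_above E k i \<le> card {k<..i}"
    unfolding steps_above_def using assms by (intro card_mono) (auto simp: tri_labels_def)
  then show ?thesis by simp
qed

lemma steps_above_Suc:
  assumes "E \<subseteq> tri_labels n 0"
  shows "steps_above E k i = steps_above E (Suc k) i + (if (i, Suc k) \<in> E then 1 else 0)"
proof -
  have "{l. k < l \<and> (i, l) \<in> E} =
      {l. Suc k < l \<and> (i, l) \<in> E} \<union> (if (i, Suc k) \<in> E then {Suc k} else {})"
    by (auto intro: Suc_lessI)
  then show ?thesis
    unfolding steps_above_def using finite_steps[OF assms, of "Suc k" i]
    by (cases "(i, Suc k) \<in> E") simp_all
qed

lemma path_familiesD:
  "E \<in> path_families n k \<Longrightarrow> k \<le> l \<Longrightarrow> l \<le> i \<Longrightarrow> Suc i < n \<Longrightarrow>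
    steps_above E l i \<le> steps_above E l (Suc i)"
  by (auto simp: path_families_def)

lemma sum_Pow_insert:
  assumes "finite A" "x \<notin> A"
  shows "(\<Sum>D\<in>Pow (insert x A). f D) = (\<Sum>D\<in>Pow A. f D + f (insert x D) :: 'a :: comm_monoid_add)"
proof -
  have "inj_on (insert x) (Pow A)" using assms(2) by (auto simp: inj_on_def)
  moreover have "Pow A \<inter> insert x ` Pow A = {}" using assms(2) by auto
  ultimately show ?thesis
    using assms(1) by (simp add: Pow_insert sum.union_disjoint sum.reindex sum.distrib)
qed

text \<open>Alternation is required for adjacent equal arguments only: particles move by unit steps, so
  they cannot cross without first meeting.\<close>
locale alternating_form =
  fixes n M :: nat and F :: "(nat \<Rightarrow> 'a :: comm_ring_1 poly) \<Rightarrow> 'a"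
  assumes linear: "\<And>v i a b p q. i < n \<Longrightarrow>
      F (v(i := smult a p + smult b q)) = a * F (v(i := p)) + b * F (v(i := q))"
    and adjacent: "\<And>v i. Suc i < n \<Longrightarrow> v i = v (Suc i) \<Longrightarrow> F v = 0"
    and cong: "\<And>v w. (\<And>i. i < n \<Longrightarrow> v i = w i) \<Longrightarrow> F v = F w"
    and basis: "\<And>s. (\<And>i. Suc i < n \<Longrightarrow> s i < s (Suc i)) \<Longrightarrow> (\<And>i. i < n \<Longrightarrow> s i < M) \<Longrightarrow>
      F (\<lambda>i. monom 1 (s i)) = 1"
begin

text \<open>All rows of \<open>A\<close> are split at once, so that one label is processed for every
  particle before collisions are examined. \<open>h\<close> is arbitrary because the induction
  stores an already split row there.\<close>

lemma expand:
  assumes "finite A" and "A \<subseteq> {..<n}"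
  shows "F (\<lambda>i. if i \<in> A then smult (a i) (f i) + smult (b i) (g i) else h i) =
    (\<Sum>D\<in>Pow A. (\<Prod>i\<in>A. if i \<in> D then b i else a i) *
      F (\<lambda>i. if i \<in> A then if i \<in> D then g i else f i else h i))"
  using assms
proof (induction A arbitrary: h rule: finite_induct)
  case (insert x A)
  let ?v = "\<lambda>i. if i \<in> A then smult (a i) (f i) + smult (b i) (g i) else h i"
  have upd: "?v(x := p) =
      (\<lambda>i. if i \<in> A then smult (a i) (f i) + smult (b i) (g i) else (h(x := p)) i)" for p
    using insert.hyps by auto
  have "F (\<lambda>i. if i \<in> insert x A then smult (a i) (f i) + smult (b i) (g i) else h i) =
      F (?v(x := smult (a x) (f x) + smult (b x) (g x)))"
    by (rule arg_cong[of _ _ F]) auto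
  also have "\<dots> = a x * F (?v(x := f x)) + b x * F (?v(x := g x))"
    using insert.prems by (intro linear) auto
  also have "\<dots> = (\<Sum>D\<in>Pow A.
      a x * ((\<Prod>i\<in>A. if i \<in> D then b i else a i) *
        F (\<lambda>i. if i \<in> A then if i \<in> D then g i else f i else (h(x := f x)) i)) +
      b x * ((\<Prod>i\<in>A. if i \<in> D then b i else a i) *
        F (\<lambda>i. if i \<in> A then if i \<in> D then g i else f i else (h(x := g x)) i)))"
    unfolding upd using insert.prems by (subst (1 2) insert.IH) (auto simp: sum_distrib_left sum.distrib)
  also have "\<dots> = (\<Sum>D\<in>Pow A.
      (\<Prod>i\<in>insert x A. if i \<in> D then b i else a i) *
        F (\<lambda>i. if i \<in> insert x A then if i \<in> D then g i else f i else h i) +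
      (\<Prod>i\<in>insert x A. if i \<in> insert x D then b i else a i) *
        F (\<lambda>i. if i \<in> insert x A then if i \<in> insert x D then g i else f i else h i))"
  proof (intro sum.cong refl arg_cong2[of _ _ _ _ "(+)"])
    fix D assume D: "D \<in> Pow A"
    then have "x \<notin> D" using insert.hyps by auto
    have "(\<Prod>i\<in>A. if i \<in> insert x D then b i else a i) = (\<Prod>i\<in>A. if i \<in> D then b i else a i)"
      using insert.hyps by (intro prod.cong) auto
    moreover have "(\<lambda>i. if i \<in> A then if i \<in> D then g i else f i else (h(x := g x)) i) =
        (\<lambda>i. if i \<in> insert x A then if i \<in> insert x D then g i else f i else h i)"
      "(\<lambda>i. if i \<in> A then if i \<in> D then g i else f i else (h(x := f x)) i) =
        (\<lambda>i. if i \<in> insert x A then if i \<in> D then g i else f i else h i)"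
      using insert.hyps \<open>x \<notin> D\<close> by (auto simp: fun_eq_iff)
    ultimately show
      "a x * ((\<Prod>i\<in>A. if i \<in> D then b i else a i) *
        F (\<lambda>i. if i \<in> A then if i \<in> D then g i else f i else (h(x := f x)) i)) =
      (\<Prod>i\<in>insert x A. if i \<in> D then b i else a i) *
        F (\<lambda>i. if i \<in> insert x A then if i \<in> D then g i else f i else h i)"
      "b x * ((\<Prod>i\<in>A. if i \<in> D then b i else a i) *
        F (\<lambda>i. if i \<in> A then if i \<in> D then g i else f i else (h(x := g x)) i)) =
      (\<Prod>i\<in>insert x A. if i \<in> insert x D then b i else a i) *
        F (\<lambda>i. if i \<in> insert x A then if i \<in> insert x D then g i else f i else h i)"
      using insert.hyps \<open>x \<notin> D\<close> by (auto simp: mult.assoc)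
  qed
  also have "\<dots> = (\<Sum>D\<in>Pow (insert x A). (\<Prod>i\<in>insert x A. if i \<in> D then b i else a i) *
      F (\<lambda>i. if i \<in> insert x A then if i \<in> D then g i else f i else h i))"
    using insert.hyps by (intro sum_Pow_insert[symmetric])
  finally show ?case .
qed simp

context
  fixes a b :: "nat \<Rightarrow> nat \<Rightarrow> 'a"
  assumes uniform: "\<And>l i. l < i \<Longrightarrow> a l i = a l (Suc i)" "\<And>l i. l < i \<Longrightarrow> b l i = b l (Suc i)"
    and size: "2 * n \<le> Suc M"
begin

abbreviation (input) fac where "fac k i \<equiv> \<Prod>l\<in>{1..min k i}. [:a l i, b l i:]"

abbreviation (input) wt where
  "wt k E \<equiv> \<Prod>(i, l)\<in>tri_labels n k. if (i, l) \<in> E then b l i else a l i"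

text \<open>Labels are expanded from the largest down: \<open>wt k E\<close> records the choices
  made so far, \<open>fac k i\<close> holds the factors still unexpanded. A choice after which two
  neighbours share a position gives them equal rows, so its term drops out and only path families
  survive.\<close>

lemma process_labels:
  assumes "k \<le> n"
  shows "F (\<lambda>i. monom 1 i * (\<Prod>l\<in>{1..i}. [:a l i, b l i:])) =
    (\<Sum>E\<in>path_families n k. wt k E * F (\<lambda>i. monom 1 (i + steps_above E k i) * fac k i))"
  using assms
proof (induction k rule: inc_induct)
  case base
  have "tri_labels n n = {}" by (auto simp: tri_labels_def)
  then have "path_families n n = {{}}" by (auto simp: path_families_def steps_above_def)
  moreover have "F (\<lambda>i. monom 1 i * (\<Prod>l\<in>{1..i}. [:a l i, b l i:])) = F (\<lambda>i. monom 1 i * fac n i)"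
    by (rule cong) (simp add: min_def)
  ultimately show ?case using \<open>tri_labels n n = {}\<close> by (simp add: steps_above_def)
next
  case (step k)
  define A where "A = {Suc k..<n}"
  define h where "h E = wt k E * F (\<lambda>i. monom 1 (i + steps_above E k i) * fac k i)" for E
  define j :: "(nat \<times> nat) set \<times> nat set \<Rightarrow> (nat \<times> nat) set"
    where "j = (\<lambda>(E, D). E \<union> D \<times> {Suc k})"
  have mem: "(i, l) \<in> j (E, D) \<longleftrightarrow> (if l = Suc k then i \<in> D else (i, l) \<in> E)"
    if "E \<in> path_families n (Suc k)" for E D i l
    using that by (auto simp: j_def path_families_def tri_labels_def)
  have above: "steps_above (j (E, D)) l i = steps_above E l i"
    if "E \<in> path_families n (Suc k)" "Suc k \<le> l" for E D l i
    using that by (auto simp: steps_above_def mem intro!: arg_cong[of _ _ card])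
  have sub: "j (E, D) \<subseteq> tri_labels n k"
    if "E \<in> path_families n (Suc k)" "D \<subseteq> A" for E D
    using that by (auto simp: j_def path_families_def tri_labels_def A_def)
  have count: "steps_above (j (E, D)) k i = steps_above E (Suc k) i + (if i \<in> D then 1 else 0)"
    if "E \<in> path_families n (Suc k)" "D \<subseteq> A" for E D i
    using steps_above_Suc[OF tri_labels_mono[OF sub[OF that]], of k i] above[OF that(1), of "Suc k" D i]
    by (simp add: mem[OF that(1)])
  have expand_step: "wt (Suc k) E * F (\<lambda>i. monom 1 (i + steps_above E (Suc k) i) * fac (Suc k) i) =
      (\<Sum>D\<in>Pow A. h (j (E, D)))" if E: "E \<in> path_families n (Suc k)" for E
  proof -
    let ?c = "\<lambda>i. i + steps_above E (Suc k) i"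
    have "F (\<lambda>i. monom 1 (?c i) * fac (Suc k) i) =
        F (\<lambda>i. if i \<in> A then smult (a (Suc k) i) (monom 1 (?c i) * fac k i) +
            smult (b (Suc k) i) (monom 1 (Suc (?c i)) * fac k i)
          else monom 1 (?c i) * fac k i)"
    proof (rule cong)
      fix i assume "i < n"
      have "monom 1 (?c i) * (fac k i * [:a (Suc k) i, b (Suc k) i:]) =
          smult (a (Suc k) i) (monom 1 (?c i) * fac k i) +
          smult (b (Suc k) i) (monom 1 (Suc (?c i)) * fac k i)"
        by (simp add: monom_Suc algebra_simps)
      moreover have "fac (Suc k) i = fac k i * [:a (Suc k) i, b (Suc k) i:]" if "Suc k \<le> i"
        using that by (simp add: min_def mult.commute)
      moreover have "fac (Suc k) i = fac k i" if "i \<le> k"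
        using that by (simp add: min_def)
      ultimately show "monom 1 (?c i) * fac (Suc k) i =
          (if i \<in> A then smult (a (Suc k) i) (monom 1 (?c i) * fac k i) +
            smult (b (Suc k) i) (monom 1 (Suc (?c i)) * fac k i)
          else monom 1 (?c i) * fac k i)"
        using \<open>i < n\<close> unfolding A_def by (cases "Suc k \<le> i") auto
    qed
    also have "\<dots> = (\<Sum>D\<in>Pow A. (\<Prod>i\<in>A. if i \<in> D then b (Suc k) i else a (Suc k) i) *
        F (\<lambda>i. if i \<in> A then if i \<in> D then monom 1 (Suc (?c i)) * fac k i
            else monom 1 (?c i) * fac k i else monom 1 (?c i) * fac k i))"
      by (rule expand) (auto simp: A_def)
    also have "wt (Suc k) E * \<dots> = (\<Sum>D\<in>Pow A. h (j (E, D)))"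
      unfolding sum_distrib_left
    proof (intro sum.cong refl)
      fix D assume "D \<in> Pow A"
      then have D: "D \<subseteq> A" by simp
      have "wt k (j (E, D)) = wt (Suc k) (j (E, D)) *
          (\<Prod>(i, l)\<in>A \<times> {Suc k}. if (i, l) \<in> j (E, D) then b l i else a l i)"
        unfolding tri_labels_step[of n k] A_def
        by (rule prod.union_disjoint) (simp, simp, auto simp: tri_labels_def)
      also have "wt (Suc k) (j (E, D)) = wt (Suc k) E"
        by (rule prod.cong) (auto simp: mem[OF E] tri_labels_def)
      also have "(\<Prod>(i, l)\<in>A \<times> {Suc k}. if (i, l) \<in> j (E, D) then b l i else a l i) =
          (\<Prod>i\<in>A. if i \<in> D then b (Suc k) i else a (Suc k) i)"
        by (rule prod.reindex_bij_witness[of _ "\<lambda>i. (i, Suc k)" fst]) (auto simp: mem[OF E])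
      finally have w: "wt k (j (E, D)) =
          wt (Suc k) E * (\<Prod>i\<in>A. if i \<in> D then b (Suc k) i else a (Suc k) i)" .
      have "(\<lambda>i. if i \<in> A then if i \<in> D then monom 1 (Suc (?c i)) * fac k i
            else monom 1 (?c i) * fac k i else monom 1 (?c i) * fac k i) =
          (\<lambda>i. monom 1 (i + steps_above (j (E, D)) k i) * fac k i)"
        using D by (auto simp: fun_eq_iff count[OF E D])
      then show "wt (Suc k) E * ((\<Prod>i\<in>A. if i \<in> D then b (Suc k) i else a (Suc k) i) *
          F (\<lambda>i. if i \<in> A then if i \<in> D then monom 1 (Suc (?c i)) * fac k i
            else monom 1 (?c i) * fac k i else monom 1 (?c i) * fac k i)) = h (j (E, D))"
        unfolding h_def w by (simp only: mult.assoc)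
    qed
    finally show ?thesis .
  qed
  have collide: "h (j (E, D)) = 0"
    if E: "E \<in> path_families n (Suc k)" and D: "D \<subseteq> A" and no: "j (E, D) \<notin> path_families n k" for E D
  proof -
    from no sub[OF E D] obtain l i where li: "k \<le> l" "l \<le> i" "Suc i < n"
        "\<not> steps_above (j (E, D)) l i \<le> steps_above (j (E, D)) l (Suc i)"
      unfolding path_families_def by blast
    have "l = k"
    proof (rule ccontr)
      assume "l \<noteq> k"
      then have "Suc k \<le> l" using li by simp
      then show False using li path_familiesD[OF E] above[OF E] by simp
    qed
    \<comment> \<open>Particle \<open>k\<close> has no label above \<open>k\<close>, so it has not
      moved and cannot have overtaken its neighbour.\<close>
    have "k < i"
    proof (rule ccontr)
      assume "\<not> k < i"
      then have "steps_above (j (E, D)) l i = 0"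
        using steps_above_le[OF tri_labels_mono[OF sub[OF E D]], of l i] li \<open>l = k\<close> by simp
      then show False using li by simp
    qed
    then have "steps_above E (Suc k) i \<le> steps_above E (Suc k) (Suc i)"
      using path_familiesD[OF E] li by simp
    \<comment> \<open>The order held before this label, and the label changes each count by at most
      one; a violation therefore means that the two positions coincide.\<close>
    then have eq: "steps_above (j (E, D)) k i = Suc (steps_above (j (E, D)) k (Suc i))"
      using li \<open>l = k\<close> by (auto simp: count[OF E D] split: if_splits)
    have "fac k i = fac k (Suc i)"
    proof (rule prod.cong)
      fix l assume "l \<in> {1..min k (Suc i)}"
      then have "l < i" using \<open>k < i\<close> by simp
      then show "[:a l i, b l i:] = [:a l (Suc i), b l (Suc i):]"
        by (simp only: uniform[of l i])
    qed (use \<open>k < i\<close> in simp)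
    then have "F (\<lambda>i. monom 1 (i + steps_above (j (E, D)) k i) * fac k i) = 0"
      using li eq by (intro adjacent[of i]) auto
    then show ?thesis by (simp add: h_def)
  qed
  have "(\<Sum>E\<in>path_families n (Suc k). wt (Suc k) E *
        F (\<lambda>i. monom 1 (i + steps_above E (Suc k) i) * fac (Suc k) i)) =
      (\<Sum>E\<in>path_families n (Suc k). \<Sum>D\<in>Pow A. h (j (E, D)))"
    by (intro sum.cong refl expand_step)
  also have "\<dots> = (\<Sum>z\<in>path_families n (Suc k) \<times> Pow A. h (j z))"
    by (simp add: sum.cartesian_product split_def)
  also have "\<dots> = (\<Sum>E\<in>j ` (path_families n (Suc k) \<times> Pow A). h E)"
  proof (rule sum.reindex[symmetric, unfolded o_def])
    show "inj_on j (path_families n (Suc k) \<times> Pow A)"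
    proof (rule inj_onI, clarify)
      fix E D E' D'
      assume E: "E \<in> path_families n (Suc k)" "E' \<in> path_families n (Suc k)"
        and eq: "j (E, D) = j (E', D')"
      have "(i, Suc k) \<notin> E" "(i, Suc k) \<notin> E'" for i
        using E by (auto simp: path_families_def tri_labels_def)
      then have "(i, l) \<in> E \<longleftrightarrow> (i, l) \<in> E'" "i \<in> D \<longleftrightarrow> i \<in> D'" for i l
        using mem[OF E(1), of i l D] mem[OF E(2), of i l D'] mem[OF E(1), of i "Suc k" D]
          mem[OF E(2), of i "Suc k" D'] eq by (auto split: if_splits)
      then show "E = E' \<and> D = D'" by auto
    qed
  qed
  also have "\<dots> = (\<Sum>E\<in>path_families n k. h E)"
  proof (rule sum.mono_neutral_right)
    show "finite (j ` (path_families n (Suc k) \<times> Pow A))"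
      by (simp add: A_def)
    show "\<forall>E\<in>j ` (path_families n (Suc k) \<times> Pow A) - path_families n k. h E = 0"
      using collide by auto
    show "path_families n k \<subseteq> j ` (path_families n (Suc k) \<times> Pow A)"
    proof
      fix E assume E: "E \<in> path_families n k"
      define E' D where "E' = E \<inter> tri_labels n (Suc k)" and "D = {i. (i, Suc k) \<in> E}"
      have "E \<subseteq> tri_labels n k" using E by (simp add: path_families_def)
      then have "E = j (E', D)" "D \<subseteq> A"
        unfolding E'_def D_def j_def A_def tri_labels_step[of n k] by (auto simp: tri_labels_def)
      moreover have "steps_above E' l i = steps_above E l i" if "Suc k \<le> l" for l i
        using that \<open>E \<subseteq> tri_labels n k\<close> unfolding steps_above_def E'_def
        by (intro arg_cong[of _ _ card]) (auto simp: tri_labels_def)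
      then have "E' \<in> path_families n (Suc k)"
        using E unfolding path_families_def by (auto simp: E'_def)
      ultimately show "E \<in> j ` (path_families n (Suc k) \<times> Pow A)" by auto
    qed
  qed
  finally show ?case
    unfolding step.IH h_def .
qed

text \<open>Once all labels are expanded the rows are monomials with increasing exponents, at most
  \<open>2 * i < M\<close> for particle \<open>i\<close>, so \<open>basis\<close> evaluates each
  term to 1. The result no longer mentions \<open>F\<close>, hence two alternating forms agree on
  these rows.\<close>

theorem sum_over_path_families:
  "F (\<lambda>i. monom 1 i * (\<Prod>l\<in>{1..i}. [:a l i, b l i:])) =
    (\<Sum>E\<in>path_families n 0. \<Prod>(i, l)\<in>tri_labels n 0. if (i, l) \<in> E then b l i else a l i)"
proof -
  have "F (\<lambda>i. monom 1 (i + steps_above E 0 i) * fac 0 i) = 1" if E: "E \<in> path_families n 0" for E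
  proof -
    have "F (\<lambda>i. monom 1 (i + steps_above E 0 i)) = 1"
    proof (rule basis)
      fix i assume "Suc i < n"
      then have "steps_above E 0 i \<le> steps_above E 0 (Suc i)"
        using path_familiesD[OF E] by simp
      then show "i + steps_above E 0 i < Suc i + steps_above E 0 (Suc i)" by simp
    next
      fix i assume "i < n"
      then show "i + steps_above E 0 i < M"
        using steps_above_le[of E n 0 i] E size by (auto simp: path_families_def)
    qed
    then show ?thesis by simp
  qed
  then show ?thesis using process_labels[of 0] by simp
qed

end

end

section \<open>The block Pfaffian and the Gram Pfaffian\<close>

text \<open>Above the diagonal \<open>S_bar_mat\<close> is the constant -1 scaled by row and column
  signs, the shape evaluated by \<open>pf_scale\<close> and \<open>pf_const\<close>.\<close>

lemma neg_one_power_diff: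
  "x < y \<Longrightarrow> (-1 :: 'a :: comm_ring_1) ^ (y - x - 1) = - ((-1) ^ x * (-1) ^ y)"
  by (auto simp: less_iff_Suc_add power_add minus_one_mult_self mult.assoc[symmetric])

lemma prod_insert_index:
  assumes "q \<le> n"
  shows "(\<Prod>z<Suc n. f z) = f q * (\<Prod>z<n. f (insert_index q z) :: 'a :: comm_monoid_mult)"
proof -
  define g where "g z = (case z of 0 \<Rightarrow> 1 | Suc z \<Rightarrow> f z)" for z
  have "gap q z = Suc (insert_index q z)" for z
    by (simp add: gap_def insert_index_def)
  then have "(\<Prod>z<Suc (Suc n). g z) = f q * (\<Prod>z<n. f (insert_index q z))"
    using prod_gap[OF assms, of g] by (simp add: g_def)
  then show ?thesis
    by (subst (asm) prod.lessThan_Suc_shift) (simp add: g_def)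
qed

text \<open>\<open>c\<close> lists the unmatched columns by their original index. Row 0 holds the
  largest exponent, so columns disappear in decreasing order and those still to be matched keep
  their position, which is the hypothesis \<open>c z = z\<close>. With \<open>Suc k\<close> rows,
  matching row 0 to column \<open>q\<close> costs \<open>(-1) ^ (k + q)\<close>: the part
  \<open>(-1) ^ q\<close> replaces the sign of the removed column, the part \<open>(-1) ^ k\<close>
  extends the product over the rows.\<close>

lemma pf_unit_rows:
  fixes A :: "nat \<Rightarrow> nat \<Rightarrow> 'a :: comm_ring_1"
  assumes "\<And>i. Suc i < k \<Longrightarrow> s i < s (Suc i)"
    and "strict_mono c"
    and "\<And>z. 0 < k \<Longrightarrow> z \<le> s (k - 1) \<Longrightarrow> c z = z"
    and "0 < k \<Longrightarrow> s (k - 1) < k + 2 * L"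
    and "\<And>x y. x < y \<Longrightarrow> y < k \<Longrightarrow> A x y = 0"
    and "\<And>x y. x < k \<Longrightarrow> k \<le> y \<Longrightarrow> A x y = (if c (y - k) = s (k - 1 - x) then 1 else 0)"
    and "\<And>x y. k \<le> x \<Longrightarrow> x < y \<Longrightarrow> A x y = - ((-1) ^ c (x - k) * (-1) ^ c (y - k))"
  shows "pf (k + L) A = (\<Prod>x<k. (-1) ^ x) * (-1) ^ L * (\<Prod>z<k + 2 * L. (-1) ^ c z)"
  using assms
proof (induction k arbitrary: A c)
  case 0
  have "pf L A = pf L (\<lambda>x y. (-1) ^ c x * (-1) ^ c y * (-1))"
    using 0 by (intro pf_cong) simp
  also have "\<dots> = (-1) ^ L * (\<Prod>z<2 * L. (-1) ^ c z)"
    unfolding pf_scale pf_const by (simp add: mult.commute)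
  finally show ?case by simp
next
  case (Suc k)
  define q where "q = s k"
  define j where "j = k + q"
  have q: "q < Suc k + 2 * L" "c q = q"
    using Suc.prems(3,4) by (auto simp: q_def)
  let ?t = "\<lambda>j. (-1) ^ j * A 0 (Suc j) * pf (k + L) (\<lambda>x y. A (gap j x) (gap j y))"
  have "?t i = 0" if "i \<noteq> j" for i
  proof (cases "i < k")
    case False
    then have "c (i - k) \<noteq> c q"
      using that strict_mono_eq[OF Suc.prems(2)] by (simp add: j_def)
    then show ?thesis using Suc.prems(6)[of 0 "Suc i"] False q by (simp add: q_def)
  qed (use Suc.prems(5) in simp)
  then have "pf (Suc k + L) A = (\<Sum>i\<in>{j}. ?t i)"
    unfolding add_Suc pf.simps using q by (intro sum.mono_neutral_right) (auto simp: j_def)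
  also have "\<dots> = (-1) ^ j * pf (k + L) (\<lambda>x y. A (gap j x) (gap j y))"
    using Suc.prems(6)[of 0 "Suc j"] q by (simp add: j_def q_def)
  also have "pf (k + L) (\<lambda>x y. A (gap j x) (gap j y)) =
      (\<Prod>x<k. (-1) ^ x) * (-1) ^ L * (\<Prod>z<k + 2 * L. (-1) ^ c (insert_index q z))"
  proof (rule Suc.IH)
    show "strict_mono (\<lambda>z. c (insert_index q z))"
      using Suc.prems(2) by (auto simp: strict_mono_def insert_index_def)
    have low: "gap j x = Suc x" if "x < k" for x
      using that by (simp add: gap_def j_def)
    have high: "gap j y = Suc k + insert_index q (y - k)" if "k \<le> y" for y
      using that by (auto simp: gap_def j_def insert_index_def)
    have prev: "s (k - 1) < q" if "0 < k"
      using Suc.prems(1)[of "k - 1"] that by (simp add: q_def)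
    show "c (insert_index q z) = z" if "0 < k" "z \<le> s (k - 1)" for z
      using prev that Suc.prems(3)[of z] by (simp add: insert_index_def q_def)
    show "s (k - 1) < k + 2 * L" if "0 < k"
      using prev that q by simp
    show "A (gap j x) (gap j y) = 0" if "x < y" "y < k" for x y
      using that Suc.prems(5) by (simp add: low)
    show "A (gap j x) (gap j y) = (if c (insert_index q (y - k)) = s (k - 1 - x) then 1 else 0)"
      if "x < k" "k \<le> y" for x y
      using that Suc.prems(6)[of "Suc x" "gap j y"] by (simp add: low high)
    show "A (gap j x) (gap j y) =
        - ((-1) ^ c (insert_index q (x - k)) * (-1) ^ c (insert_index q (y - k)))"
      if "k \<le> x" "x < y" for x y
      using that Suc.prems(7)[of "gap j x" "gap j y"] gap_less_iff[of j x y] by (simp add: high)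
  qed (use Suc.prems in auto)
  also have "(-1) ^ j * ((\<Prod>x<k. (-1) ^ x) * (-1) ^ L * (\<Prod>z<k + 2 * L. (-1) ^ c (insert_index q z))) =
      (\<Prod>x<Suc k. (-1) ^ x) * (-1) ^ L * (\<Prod>z<Suc k + 2 * L. (-1 :: 'a) ^ c z)"
    using prod_insert_index[of q "k + 2 * L" "\<lambda>z. (-1 :: 'a) ^ c z"] q
    by (simp add: j_def power_add ac_simps)
  finally show ?case .
qed

text \<open>The sign in \<open>pf_unit_rows\<close> when \<open>c\<close> is the identity: the row
  reversal and the signs of \<open>S_bar_mat\<close> compensate, which normalizes the block
  Pfaffian.\<close>

lemma sign_balance:
  "(\<Prod>x<k. (-1) ^ x) * (-1) ^ L * (\<Prod>z<k + 2 * L. (-1) ^ z) = (1 :: 'a :: comm_ring_1)"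
proof (induction L)
  case 0
  show ?case by (simp add: prod.distrib[symmetric])
next
  case (Suc L)
  have "(\<Prod>z<k + 2 * Suc L. (-1) ^ z) =
      (\<Prod>z<k + 2 * L. (-1) ^ z) * ((-1) ^ (k + 2 * L) * (-1 :: 'a) ^ Suc (k + 2 * L))"
    by (simp add: mult.assoc)
  also have "(-1) ^ (k + 2 * L) * (-1 :: 'a) ^ Suc (k + 2 * L) = -1"
    by (simp add: power_add)
  finally show ?case using Suc by simp
qed

text \<open>The index \<open>n - 1 - x\<close> is the effect of multiplying by \<open>J_mat\<close>
  on the left.\<close>

definition block_form :: "nat \<Rightarrow> nat \<Rightarrow> (nat \<Rightarrow> 'a poly) \<Rightarrow> nat \<Rightarrow> nat \<Rightarrow> 'a :: comm_ring_1" where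
  "block_form n N v x y =
     (if x < n then if y < n then 0 else coeff (v (n - 1 - x)) (y - n)
      else if y < n then - coeff (v (n - 1 - y)) (x - n)
      else S_bar_mat (n + N) $$ (x - n, y - n))"

lemma alternating_form_block:
  assumes "even N"
  shows "alternating_form n (n + N) (\<lambda>v. pf (n + N div 2) (block_form n N v :: nat \<Rightarrow> nat \<Rightarrow> 'a :: comm_ring_1))"
proof
  fix v :: "nat \<Rightarrow> 'a poly" and i a b p q assume i: "i < n"
  define r where "r = n - 1 - i"
  have r: "r < n" "n - 1 - r = i" using i by (auto simp: r_def)
  have "n - 1 - x \<noteq> i" if "x < n" "x \<noteq> r" for x
    using i that by (auto simp: r_def)
  then have off: "block_form n N (v(i := p)) x y = block_form n N (v(i := q)) x y"
    if "x \<noteq> r" "y \<noteq> r" for p q x y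
    using that unfolding block_form_def by (simp del: One_nat_def)
  have row: "block_form n N (v(i := p)) r y = (if y < n then 0 else coeff p (y - n))"
    and col: "block_form n N (v(i := p)) y r = (if y < n then 0 else - coeff p (y - n))" for p y
    using r unfolding block_form_def by (simp_all del: One_nat_def)
  show "pf (n + N div 2) (block_form n N (v(i := smult a p + smult b q))) =
      a * pf (n + N div 2) (block_form n N (v(i := p))) +
      b * pf (n + N div 2) (block_form n N (v(i := q)))"
    using r by (intro pf_linear[of r] off) (simp_all add: row col algebra_simps)
next
  fix v :: "nat \<Rightarrow> 'a poly" and i assume i: "Suc i < n" "v i = v (Suc i)"
  \<comment> \<open>Reversal sends the neighbours \<open>i\<close> and \<open>Suc i\<close> to the
    adjacent rows \<open>n - 1 - i\<close> and \<open>n - 2 - i\<close>.\<close>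
  have "n - Suc (n - 2 - i) = Suc i" "n - Suc (Suc (n - 2 - i)) = i" using i by auto
  then show "pf (n + N div 2) (block_form n N v) = 0"
    using i by (intro pf_equal_rows[of "n - 2 - i"]) (auto simp: block_form_def)
next
  fix v w :: "nat \<Rightarrow> 'a poly" assume "\<And>i. i < n \<Longrightarrow> v i = w i"
  then show "pf (n + N div 2) (block_form n N v) = pf (n + N div 2) (block_form n N w)"
    by (intro pf_cong) (simp add: block_form_def)
next
  fix s :: "nat \<Rightarrow> nat"
  assume s: "\<And>i. Suc i < n \<Longrightarrow> s i < s (Suc i)" "\<And>i. i < n \<Longrightarrow> s i < n + N"
  define L where "L = N div 2"
  have N: "N = 2 * L" using assms by (simp add: L_def)
  let ?B = "block_form n N (\<lambda>i. monom 1 (s i)) :: nat \<Rightarrow> nat \<Rightarrow> 'a"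
  let ?A = "\<lambda>x y. if n \<le> x \<and> x < y then - ((-1) ^ (x - n) * (-1) ^ (y - n)) else ?B x y"
  have "pf (n + L) ?B = pf (n + L) ?A"
  proof (rule pf_cong)
    fix x y assume "x < y" "y < 2 * (n + L)"
    then show "?B x y = ?A x y"
      using neg_one_power_diff[of "x - n" "y - n"]
      by (auto simp: block_form_def S_bar_mat_def N)
  qed
  also have "\<dots> = (\<Prod>x<n. (-1) ^ x) * (-1) ^ L * (\<Prod>z<n + 2 * L. (-1) ^ z)"
    using s by (intro pf_unit_rows[of n s "\<lambda>z. z"]) (auto simp: block_form_def N strict_mono_def)
  finally show "pf (n + N div 2) ?B = 1"
    by (simp add: sign_balance L_def[symmetric])
qed

section \<open>The pairing of polynomials by the order of exponents\<close>

text \<open>On monomials with increasing exponents this form takes the value 1, so its Pfaffian is another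
  normalized alternating form. For an odd number of vectors the monomial of degree \<open>M\<close>, above all
  other exponents, is appended.\<close>
definition gram :: "nat \<Rightarrow> 'a poly \<Rightarrow> 'a poly \<Rightarrow> 'a :: comm_ring_1" where
  "gram M f g = (\<Sum>y<M. \<Sum>x<y. coeff f x * coeff g y - coeff f y * coeff g x)"

lemma gram_self [simp]: "gram M f f = 0"
  by (simp add: gram_def mult.commute)

lemma gram_swap: "gram M f g = - gram M g f"
  by (simp add: gram_def sum_negf[symmetric] mult.commute)

lemma gram_linear_left:
  "gram M (smult a p + smult b q) g = a * gram M p g + b * gram M q g"
  unfolding gram_def sum_distrib_left sum.distrib[symmetric]
  by (intro sum.cong) (auto simp: algebra_simps)

lemma gram_linear_right:
  "gram M g (smult a p + smult b q) = a * gram M g p + b * gram M g q"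
  using gram_linear_left[of M a p b q g] by (simp add: gram_swap[of M g])

lemma gram_monom_left:
  assumes "x < M"
  shows "gram M (monom 1 x) g = (\<Sum>y\<in>{x<..<M}. coeff g y) - (\<Sum>y<x. coeff g y)"
proof -
  have "gram M (monom 1 x) g =
      (\<Sum>y<M. \<Sum>z<y. if x = z then coeff g y else 0) -
      (\<Sum>y<M. \<Sum>z<y. if x = y then coeff g z else 0)"
    unfolding gram_def sum_subtractf[symmetric] by (intro sum.cong) auto
  also have "(\<Sum>y<M. \<Sum>z<y. if x = z then coeff g y else 0) = (\<Sum>y<M. if x < y then coeff g y else 0)"
    by (intro sum.cong) (auto simp: sum.delta)
  also have "\<dots> = (\<Sum>y\<in>{x<..<M}. coeff g y)"
    by (rule sum.mono_neutral_cong_right) auto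
  also have "(\<Sum>y<M. \<Sum>z<y. if x = y then coeff g z else 0) =
      (\<Sum>y<M. if x = y then \<Sum>z<y. coeff g z else 0)"
    by (intro sum.cong) auto
  also have "\<dots> = (\<Sum>z<x. coeff g z)"
    using assms by (simp add: sum.delta)
  finally show ?thesis .
qed

lemma gram_monom_monom: "x < y \<Longrightarrow> y < M \<Longrightarrow> gram M (monom 1 x) (monom 1 y) = 1"
  by (subst gram_monom_left) auto

lemma gram_pCons: "gram (Suc M) (pCons 0 f) (pCons 0 g) = gram M f g"
  unfolding gram_def
  by (subst sum.lessThan_Suc_shift) (simp add: sum.lessThan_Suc_shift del: sum.lessThan_Suc)

lemma gram_shift:
  assumes "degree f < M" and "degree g < M"
  shows "gram (Suc M) (pCons 0 f) (pCons 0 g) = gram (Suc M) f g"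
  unfolding gram_pCons using assms by (simp add: gram_def coeff_eq_0)

text \<open>The coefficients of \<open>gram\<close> depend only on the difference of the exponents.\<close>
lemma gram_reflect_factor:
  assumes "degree f < M" and "degree g < M"
  shows "gram (Suc M) ([:a, b:] * f) ([:a, b:] * g) = gram (Suc M) ([:b, a:] * f) ([:b, a:] * g)"
proof -
  have "[:a, b:] * f = smult a f + smult b (pCons 0 f)" for a b and f :: "'a poly"
    by simp
  \<comment> \<open>By bilinearity and \<open>gram_shift\<close> the left side is (a^2 + b^2)
    gram(f, g) + a b (gram(f, x g) + gram(x f, g)), which is symmetric in a and b.\<close>
  then show ?thesis
    by (simp only: gram_linear_left gram_linear_right gram_shift[OF assms]) (simp add: algebra_simps)
qed

lemma poly_1_eq_sum_coeff:
  fixes g :: "'a :: comm_ring_1 poly"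
  assumes "degree g < M"
  shows "poly g 1 = (\<Sum>y<M. coeff g y)"
proof -
  have "poly g 1 = (\<Sum>y\<le>degree g. coeff g y)" by (simp add: poly_altdef)
  also have "\<dots> = (\<Sum>y<M. coeff g y)"
    using assms by (intro sum.mono_neutral_left) (auto simp: coeff_eq_0)
  finally show ?thesis .
qed

text \<open>All exponents of \<open>f\<close> lie below \<open>M\<close>, so every term enters with
  the same sign. Evaluation at 1 does not distinguish 1 + w x from w + x, so the appended monomial
  respects the exchange of rows.\<close>

lemma gram_monom_right:
  assumes "degree f < M"
  shows "gram (Suc M) f (monom 1 M) = poly f 1"
proof -
  have "{M<..<Suc M} = {}" by auto
  then show ?thesis
    using gram_monom_left[of M "Suc M" f] poly_1_eq_sum_coeff[OF assms] by (simp add: gram_swap[of _ f])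
qed

lemma strict_chain_less:
  fixes s :: "nat \<Rightarrow> nat"
  assumes "\<And>i. Suc i < n \<Longrightarrow> s i < s (Suc i)" and "x < y" and "y < n"
  shows "s x < s y"
  using assms(2,3)
proof (induction y)
  case (Suc y)
  then show ?case using assms(1)[of y] by (cases "x = y") auto
qed simp

text \<open>\<open>Suc M\<close> lets the pairing see the appended monomial of degree
  \<open>M\<close>. For even \<open>n\<close> the index \<open>n\<close> lies outside the Pfaffian,
  so one formula serves both parities. On increasing monomials every entry above the diagonal is
  1.\<close>

lemma alternating_form_gram:
  fixes M n :: nat
  defines "w \<equiv> \<lambda>v :: nat \<Rightarrow> 'a :: comm_ring_1 poly. v(n := monom 1 M)"
  shows "alternating_form n M (\<lambda>v. pf ((n + n mod 2) div 2) (\<lambda>x y. gram (Suc M) (w v x) (w v y)))"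
proof
  let ?m = "(n + n mod 2) div 2"
  have m: "2 * ?m = n + n mod 2" by presburger
  have n: "y \<le> n" if "y < 2 * ?m" for y using that unfolding m by (cases "even n") (auto simp: odd_iff_mod_2_eq_one)
  {
    fix v :: "nat \<Rightarrow> 'a poly" and i a b p q assume i: "i < n"
    show "pf ?m (\<lambda>x y. gram (Suc M) (w (v(i := smult a p + smult b q)) x) (w (v(i := smult a p + smult b q)) y)) =
      a * pf ?m (\<lambda>x y. gram (Suc M) (w (v(i := p)) x) (w (v(i := p)) y)) +
      b * pf ?m (\<lambda>x y. gram (Suc M) (w (v(i := q)) x) (w (v(i := q)) y))"
      using i m by (intro pf_linear[of i]) (auto simp: w_def gram_linear_left gram_linear_right)
  next
    fix v :: "nat \<Rightarrow> 'a poly" and i assume "Suc i < n" "v i = v (Suc i)"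
    then show "pf ?m (\<lambda>x y. gram (Suc M) (w v x) (w v y)) = 0"
      using m by (intro pf_equal_rows[of i]) (auto simp: w_def)
  next
    fix v v' :: "nat \<Rightarrow> 'a poly" assume v: "\<And>i. i < n \<Longrightarrow> v i = v' i"
    have "w v x = w v' x" if "x < 2 * ?m" for x
      using v n[OF that] by (cases "x = n") (auto simp: w_def)
    then show "pf ?m (\<lambda>x y. gram (Suc M) (w v x) (w v y)) = pf ?m (\<lambda>x y. gram (Suc M) (w v' x) (w v' y))"
      by (intro pf_cong) auto
  next
    fix s :: "nat \<Rightarrow> nat"
    assume s: "\<And>i. Suc i < n \<Longrightarrow> s i < s (Suc i)" "\<And>i. i < n \<Longrightarrow> s i < M"
    have "pf ?m (\<lambda>x y. gram (Suc M) (w (\<lambda>i. monom 1 (s i)) x) (w (\<lambda>i. monom 1 (s i)) y)) =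
        pf ?m (\<lambda>x y. 1 :: 'a)"
    proof (rule pf_cong)
      fix x y assume xy: "x < y" "y < 2 * ?m"
      have "s x < s y" if "y < n" using strict_chain_less[of n s x y] s(1) xy that by blast
      then show "gram (Suc M) (w (\<lambda>i. monom 1 (s i)) x) (w (\<lambda>i. monom 1 (s i)) y) = (1 :: 'a)"
        using s(2)[of x] s(2)[of y] xy n[of y] by (auto simp: w_def gram_monom_monom le_less)
    qed
    then show "pf ?m (\<lambda>x y. gram (Suc M) (w (\<lambda>i. monom 1 (s i)) x) (w (\<lambda>i. monom 1 (s i)) y)) = (1 :: 'a)"
      by (simp add: pf_const)
  }
qed

section \<open>Rows of the matrix as products of linear factors\<close>

text \<open>Label \<open>min r i\<close> carries \<open>u\<close>: a particle with fewer than \<open>r\<close> labels takes it on its first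
  step, which matches the indicator terms of \<open>U_stat\<close>.\<close>
definition label_weight :: "nat \<Rightarrow> 'a \<Rightarrow> 'a \<Rightarrow> nat \<Rightarrow> nat \<Rightarrow> 'a :: comm_ring_1" where
  "label_weight r t u l i = (if l = 1 then t else 1) * (if l = min r i then u else 1)"

text \<open>The labels 1 and \<open>min r i\<close> differ here, so the product contains one
  \<open>t\<close>, one \<open>u\<close> and otherwise ones; this is where the dependence on
  \<open>r\<close> disappears.\<close>

lemma prod_label_weight:
  fixes \<phi> :: "'a :: comm_ring_1 \<Rightarrow> 'b :: comm_monoid_mult"
  assumes "2 \<le> r" and "2 \<le> i"
  shows "(\<Prod>l\<in>{1..i}. \<phi> (label_weight r t u l i)) = \<phi> t * \<phi> u * \<phi> 1 ^ (i - 2)"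
proof -
  define q where "q = min r i"
  have q: "1 \<noteq> q" "{1, q} \<subseteq> {1..i}" using assms by (auto simp: q_def)
  have "(\<Prod>l\<in>{1..i}. \<phi> (label_weight r t u l i)) =
      (\<Prod>l\<in>{1..i} - {1, q}. \<phi> (label_weight r t u l i)) * (\<Prod>l\<in>{1, q}. \<phi> (label_weight r t u l i))"
    using q by (intro prod.subset_diff) auto
  also have "(\<Prod>l\<in>{1, q}. \<phi> (label_weight r t u l i)) = \<phi> t * \<phi> u"
    using q by (simp add: label_weight_def q_def[symmetric])
  also have "(\<Prod>l\<in>{1..i} - {1, q}. \<phi> (label_weight r t u l i)) = (\<Prod>l\<in>{1..i} - {1, q}. \<phi> 1)"
    by (intro prod.cong) (auto simp: label_weight_def q_def[symmetric])
  also have "\<dots> = \<phi> 1 ^ (i - 2)"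
    using q by (simp add: card_Diff_subset numeral_2_eq_2)
  finally show ?thesis by (simp add: mult.commute)
qed

text \<open>\<open>\<phi>\<close> selects the orientation: \<open>[:1, w:]\<close> weights the steps
  made and yields the rows of \<open>B_mat\<close>, \<open>[:w, 1:]\<close> weights the steps not
  made.\<close>

definition row_poly :: "('a \<Rightarrow> 'a poly) \<Rightarrow> nat \<Rightarrow> 'a \<Rightarrow> 'a \<Rightarrow> nat \<Rightarrow> 'a :: comm_ring_1 poly" where
  "row_poly \<phi> r t u i = monom 1 i * (\<Prod>l\<in>{1..i}. \<phi> (label_weight r t u l i))"

lemma row_poly_0 [simp]: "row_poly \<phi> r t u 0 = monom 1 0"
  by (simp add: row_poly_def)

lemma row_poly_1: "2 \<le> r \<Longrightarrow> row_poly \<phi> r t u (Suc 0) = monom 1 1 * \<phi> (t * u)"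
  by (simp add: row_poly_def label_weight_def)

lemma row_poly_ge_2:
  "2 \<le> r \<Longrightarrow> 2 \<le> i \<Longrightarrow> row_poly \<phi> r t u i = monom 1 i * (\<phi> t * \<phi> u * \<phi> 1 ^ (i - 2))"
  unfolding row_poly_def by (subst prod_label_weight) auto

lemma coeff_row_poly_low: "k < i \<Longrightarrow> coeff (row_poly \<phi> r t u i) k = 0"
  by (simp add: row_poly_def coeff_monom_mult)

lemma degree_linear_le: "degree [:a, b:] \<le> 1"
  by simp

lemma degree_row_poly:
  assumes "\<And>w. degree (\<phi> w) \<le> 1"
  shows "degree (row_poly \<phi> r t u i) \<le> 2 * i"
proof -
  have "degree (\<Prod>l\<in>{1..i}. \<phi> (label_weight r t u l i)) \<le>
      (\<Sum>l\<in>{1..i}. degree (\<phi> (label_weight r t u l i)))"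
    using degree_prod_sum_le[of "{1..i}" "\<lambda>l. \<phi> (label_weight r t u l i)"] by (simp add: o_def)
  also have "\<dots> \<le> (\<Sum>l\<in>{1..i}. 1)" by (intro sum_mono assms)
  finally have "degree (\<Prod>l\<in>{1..i}. \<phi> (label_weight r t u l i)) \<le> i" by simp
  then show ?thesis
    unfolding row_poly_def
    using degree_mult_le[of "monom 1 i" "\<Prod>l\<in>{1..i}. \<phi> (label_weight r t u l i)"]
      degree_monom_le[of "1 :: 'a" i] by linarith
qed

lemma coeff_linear_power: "coeff ([:1, 1:] ^ m) k = of_nat (m choose k)"
proof (induction m arbitrary: k)
  case (Suc m)
  have "[:1, 1:] ^ Suc m = [:1, 1:] ^ m + pCons 0 ([:1, 1:] ^ m :: 'a poly)" by simp
  then show ?case by (cases k) (simp_all add: Suc add.commute)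
next
  case 0
  show ?case by (cases k) (simp_all add: coeff_1)
qed

lemma binom_eq_coeff:
  "binom m (int j - int i) = (if j < i then 0 else coeff ([:1, 1:] ^ m) (j - i) :: 'a :: comm_ring_1)"
  by (simp add: binom_def coeff_linear_power nat_diff_distrib')

lemma B_mat_eq_coeff:
  fixes t u :: "'a :: comm_ring_1"
  assumes "2 \<le> r" and "i < n" and "j < n + N"
  shows "B_mat n N t u $$ (i, j) = coeff (row_poly (\<lambda>w. [:1, w:]) r t u i) j"
proof -
  consider "i = 0" | "i = 1" | "2 \<le> i" by linarith
  then show ?thesis
  proof cases
    case 1
    then show ?thesis using assms by (simp add: B_mat_def)
  next
    case 2
    then show ?thesis
      using assms by (auto simp: B_mat_def row_poly_1 coeff_monom_mult coeff_pCons split: nat.splits)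
  next
    case 3
    let ?f = "[:1, 1:] ^ (i - 2) :: 'a poly"
    have row: "row_poly (\<lambda>w. [:1, w:]) r t u i =
        monom 1 i * (?f + smult (t + u) (pCons 0 ?f) + smult (t * u) (pCons 0 (pCons 0 ?f)))"
      unfolding row_poly_ge_2[OF assms(1) 3] by (simp add: algebra_simps)
    have "coeff (row_poly (\<lambda>w. [:1, w:]) r t u i) j =
        (if j < i then 0 else coeff ?f (j - i)) +
        (if j < i + 1 then 0 else coeff ?f (j - (i + 1))) * (t + u) +
        (if j < i + 2 then 0 else coeff ?f (j - (i + 2))) * (t * u)"
    proof (cases "j < i")
      case False
      then obtain d where d: "j = i + d" by (auto simp: not_less le_iff_add)
      consider "d = 0" | "d = 1" | e where "d = Suc (Suc e)"
        by (metis One_nat_def not0_implies_Suc)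
      then show ?thesis
        unfolding row d by cases (simp_all add: coeff_monom_mult mult.commute)
    qed (simp add: row coeff_monom_mult)
    also have "\<dots> = B_mat n N t u $$ (i, j)"
      unfolding binom_eq_coeff[symmetric] using assms 3 by (simp add: B_mat_def diff_diff_eq add.commute)
    finally show ?thesis by simp
  qed
qed

lemma pfaffian_eq_pf_block:
  fixes t u :: "'a :: comm_ring_1"
  assumes "even N" and "2 \<le> r"
  shows "pfaffian (four_block_mat (0\<^sub>m n n) (J_mat n * B_mat n N t u)
      (- (transpose_mat (B_mat n N t u) * J_mat n)) (S_bar_mat (n + N))) =
    pf (n + N div 2) (block_form n N (row_poly (\<lambda>w. [:1, w:]) r t u))"
    (is "pfaffian ?M = _")
proof -
  have size: "2 * (n + N div 2) = n + (n + N)" using assms(1) by auto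
  have "pfaffian ?M = pf (n + N div 2) (\<lambda>i j. ?M $$ (i, j))"
    using size by (intro pfaffian_eq_pf) (simp add: S_bar_mat_def)
  also have "\<dots> = pf (n + N div 2) (block_form n N (row_poly (\<lambda>w. [:1, w:]) r t u))"
  proof (rule pf_cong)
    fix x y assume xy: "x < y" "y < 2 * (n + N div 2)"
    have JB: "(J_mat n * B_mat n N t u) $$ (x, z) = B_mat n N t u $$ (n - 1 - x, z)"
      if "x < n" "z < n + N" for z
    proof -
      have "(J_mat n * B_mat n N t u) $$ (x, z) =
          (\<Sum>k<n. (if k = n - 1 - x then 1 else 0) * B_mat n N t u $$ (k, z))"
        using that by (auto simp: J_mat_def B_mat_def scalar_prod_def atLeast0LessThan intro!: sum.cong)
      also have "\<dots> = (\<Sum>k<n. if k = n - 1 - x then B_mat n N t u $$ (k, z) else 0)"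
        by (intro sum.cong) auto
      also have "\<dots> = B_mat n N t u $$ (n - 1 - x, z)"
        using that by (simp add: sum.delta)
      finally show ?thesis .
    qed
    have xy': "y < n + (n + N)" using xy size by simp
    show "?M $$ (x, y) = block_form n N (row_poly (\<lambda>w. [:1, w:]) r t u) x y"
    proof (cases "x < n \<and> n \<le> y")
      case True
      then have "?M $$ (x, y) = B_mat n N t u $$ (n - 1 - x, y - n)"
        using xy' JB[of "y - n"] by (simp add: S_bar_mat_def J_mat_def B_mat_def[of n N t u])
      also have "\<dots> = coeff (row_poly (\<lambda>w. [:1, w:]) r t u (n - 1 - x)) (y - n)"
        using True xy' by (intro B_mat_eq_coeff assms) auto
      finally show ?thesis using True by (simp add: block_form_def)
    next
      case False
      then show ?thesis
        using xy xy' by (auto simp: block_form_def J_mat_def S_bar_mat_def)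
    qed
  qed
  finally show ?thesis .
qed

text \<open>For \<open>2 \<le> i\<close> both rows share the factors for \<open>t\<close> and
  \<open>u\<close>, which are reversed one at a time, and the power of 1 + x is its own reverse. Row
  0 has no factor and row 1 only 1 + t u x, so these two are computed from
  \<open>gram_monom_left\<close>.\<close>

lemma gram_row_poly_reflect:
  fixes t u :: "'a :: comm_ring_1"
  assumes "2 \<le> r" and "i < j" and "2 * j < M"
  shows "gram (Suc M) (row_poly (\<lambda>w. [:1, w:]) r t u i) (row_poly (\<lambda>w. [:1, w:]) r t u j) =
    gram (Suc M) (row_poly (\<lambda>w. [:w, 1:]) r t u i) (row_poly (\<lambda>w. [:w, 1:]) r t u j)"
    (is "gram _ (?p i) (?p j) = gram _ (?q i) (?q j)")
proof -
  have deg: "degree (?p j) < Suc M" "degree (?q j) < Suc M"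
    using degree_row_poly[where \<phi> = "\<lambda>w. [:1, w:]", OF degree_linear_le, of r t u j]
      degree_row_poly[where \<phi> = "\<lambda>w. [:w, 1:]", OF degree_linear_le, of r t u j] assms
    by auto
  have at_1: "poly (?p j) 1 = poly (?q j) 1"
    by (simp add: row_poly_def poly_prod add.commute)
  have tail: "(\<Sum>y\<in>{x<..<Suc M}. coeff f y) = poly f 1 - (\<Sum>y\<le>x. coeff f y)"
    if "degree f < Suc M" "x < Suc M" for f :: "'a poly" and x
  proof -
    have "{..<Suc M} = {..x} \<union> {x<..<Suc M}" using that by auto
    moreover have "sum (coeff f) ({..x} \<union> {x<..<Suc M}) = sum (coeff f) {..x} + sum (coeff f) {x<..<Suc M}"
      by (rule sum.union_disjoint) auto
    ultimately show ?thesis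
      using poly_1_eq_sum_coeff[OF that(1)] by simp
  qed
  consider "i = 0" | "i = 1" | "2 \<le> i" by linarith
  then show ?thesis
  proof cases
    case 1
    then show ?thesis
      using assms at_1 tail[OF deg(1), of 0] tail[OF deg(2), of 0]
        gram_monom_left[of 0 "Suc M" "?p j"] gram_monom_left[of 0 "Suc M" "?q j"]
      by (simp add: coeff_row_poly_low)
  next
    case 2
    then have j: "2 \<le> j" using assms by simp
    have lin: "gram (Suc M) (monom 1 1) f = poly f 1" "gram (Suc M) (monom 1 2) f = poly f 1 - coeff f 2"
      if "degree f < Suc M" "coeff f 0 = 0" "coeff f 1 = 0" for f :: "'a poly"
      using that tail[of f 1] tail[of f 2] assms j
      by (simp_all add: gram_monom_left numeral_2_eq_2)
    have low: "coeff (?p j) 0 = 0" "coeff (?p j) 1 = 0" "coeff (?q j) 0 = 0" "coeff (?q j) 1 = 0"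
      using j by (auto simp: coeff_row_poly_low)
    \<comment> \<open>For \<open>j = 2\<close> these coefficients are 1 and \<open>t * u\<close>,
      for larger \<open>j\<close> both vanish. This offsets the exchange of 1 and
      \<open>t * u\<close> in row 1.\<close>
    have second: "t * u * coeff (?p j) 2 = coeff (?q j) 2"
    proof (cases "j = 2")
      case True
      then show ?thesis
        unfolding row_poly_ge_2[OF assms(1) j] by (simp add: coeff_monom_mult mult.commute numeral_2_eq_2)
    qed (use j in \<open>simp add: coeff_row_poly_low\<close>)
    have "?p 1 = smult 1 (monom 1 1) + smult (t * u) (monom 1 2)"
      "?q 1 = smult (t * u) (monom 1 1) + smult 1 (monom 1 2)"
      using assms(1) by (simp_all add: row_poly_1 monom_Suc monom_0 numeral_2_eq_2)
    then show ?thesis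
      unfolding \<open>i = 1\<close> using lin[OF deg(1) low(1,2)] lin[OF deg(2) low(3,4)] at_1 second
      by (simp only: gram_linear_left) (simp add: algebra_simps)
  next
    case 3
    define f :: "nat \<Rightarrow> 'a poly" where "f i = monom 1 i * [:1, 1:] ^ (i - 2)" for i
    have degf: "degree ([:a, b:] * f k) < M" "degree (f k) < M" if "2 \<le> k" "k \<le> j" for a b :: 'a and k
    proof -
      have "degree (f k) \<le> k + (k - 2)"
        using degree_mult_le[of "monom 1 k" "[:1, 1:] ^ (k - 2) :: 'a poly"]
          degree_monom_le[of "1 :: 'a" k] degree_power_le[of "[:1, 1 :: 'a:]" "k - 2"]
        unfolding f_def by simp
      moreover have "degree ([:a, b:] * f k) \<le> degree [:a, b:] + degree (f k)"
        by (rule degree_mult_le)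
      moreover have "degree [:a, b:] \<le> 1" by (rule degree_linear_le)
      ultimately show "degree ([:a, b:] * f k) < M" "degree (f k) < M"
        using that assms(3) by linarith+
    qed
    have p: "?p k = [:1, t:] * ([:1, u:] * f k)" and q: "?q k = [:u, 1:] * ([:t, 1:] * f k)"
      if "2 \<le> k" for k
      unfolding row_poly_ge_2[OF assms(1) that] f_def by (simp_all only: ac_simps)
    have c: "[:t, 1:] * ([:1, u:] * f k) = [:1, u:] * ([:t, 1:] * f k)" for k
      by (simp only: ac_simps)
    have ij: "2 \<le> j" "i \<le> j" using 3 assms by auto
    show ?thesis
      unfolding p[OF 3] p[OF ij(1)] q[OF 3] q[OF ij(1)]
      unfolding gram_reflect_factor[OF degf(1)[OF 3 ij(2)] degf(1)[OF ij(1) order.refl], of 1 t] c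
      by (rule gram_reflect_factor[OF degf(1)[OF 3 ij(2)] degf(1)[OF ij(1) order.refl]])
  qed
qed

theorem pfaffian_eq_sum_path_families:
  fixes t u :: "'a :: comm_ring_1"
  assumes "even N" and "n - 1 \<le> N" and "2 \<le> r"
  shows "pfaffian (four_block_mat (0\<^sub>m n n) (J_mat n * B_mat n N t u)
      (- (transpose_mat (B_mat n N t u) * J_mat n)) (S_bar_mat (n + N))) =
    (\<Sum>E\<in>path_families n 0.
      \<Prod>(i, l)\<in>tri_labels n 0. if (i, l) \<in> E then 1 else label_weight r t u l i)"
proof -
  let ?M = "n + N" and ?m = "(n + n mod 2) div 2"
  let ?p = "row_poly (\<lambda>w. [:1, w:]) r t u" and ?q = "row_poly (\<lambda>w. [:w, 1:]) r t u"
  let ?w = "\<lambda>v :: nat \<Rightarrow> 'a poly. v(n := monom 1 ?M)"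
  let ?gram = "\<lambda>v. pf ?m (\<lambda>x y. gram (Suc ?M) (?w v x) (?w v y))"
  interpret blk: alternating_form n ?M "\<lambda>v. pf (n + N div 2) (block_form n N v) :: 'a"
    by (rule alternating_form_block[OF assms(1)])
  interpret gr: alternating_form n ?M ?gram
    by (rule alternating_form_gram)
  have uniform: "label_weight r t u l i = label_weight r t u l (Suc i)" if "l < i" for l i
    using that by (auto simp: label_weight_def)
  have size: "2 * n \<le> Suc ?M" using assms(2) by simp
  have "pf (n + N div 2) (block_form n N ?p) = ?gram ?p"
    using blk.sum_over_path_families[where a = "\<lambda>_ _. 1" and b = "label_weight r t u", OF refl uniform size]
      gr.sum_over_path_families[where a = "\<lambda>_ _. 1" and b = "label_weight r t u", OF refl uniform size]
    by (simp only: row_poly_def[abs_def])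
  also have "\<dots> = ?gram ?q"
  proof (rule pf_cong)
    fix x y assume xy: "x < y" "y < 2 * ?m"
    have "y \<le> n" using xy(2) by (cases "even n") (auto elim!: oddE)
    show "gram (Suc ?M) (?w ?p x) (?w ?p y) = gram (Suc ?M) (?w ?q x) (?w ?q y)"
    proof (cases "y = n")
      case True
      \<comment> \<open>The index \<open>n\<close> is reached only for odd \<open>n\<close>; the
        entry is then a pairing with the appended monomial, that is, a value at 1.\<close>
      have "degree (?p x) < ?M" "degree (?q x) < ?M"
        using degree_row_poly[where \<phi> = "\<lambda>w. [:1, w:]", OF degree_linear_le, of r t u x]
          degree_row_poly[where \<phi> = "\<lambda>w. [:w, 1:]", OF degree_linear_le, of r t u x]
          True xy(1) size by auto
      then show ?thesis
        using True xy(1) by (simp add: gram_monom_right row_poly_def poly_prod add.commute)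
    next
      case False
      then have "2 * y < ?M" using \<open>y \<le> n\<close> size by simp
      then show ?thesis
        using gram_row_poly_reflect[OF assms(3) xy(1)] False \<open>y \<le> n\<close> xy(1) by simp
    qed
  qed
  also have "\<dots> = (\<Sum>E\<in>path_families n 0.
      \<Prod>(i, l)\<in>tri_labels n 0. if (i, l) \<in> E then 1 else label_weight r t u l i)"
    using gr.sum_over_path_families[where a = "label_weight r t u" and b = "\<lambda>_ _. 1", OF uniform refl size]
    by (simp only: row_poly_def[abs_def])
  finally show ?thesis
    unfolding pfaffian_eq_pf_block[OF assms(1,3)] .
qed

section \<open>Triangular arrays as crossing sets\<close>

lemma ext_bounds:
  assumes "b \<in> tri_arrays n" and "1 \<le> s" and "s \<le> j" and "j \<le> n"
  shows "int n - int s \<le> ext n b s j" and "ext n b s j \<le> int n"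
  using assms by (auto simp: tri_arrays_def triangle_def ext_def)

lemma ext_row_mono:
  assumes "b \<in> tri_arrays n" and "1 \<le> s" and "s \<le> j" and "j \<le> k" and "k \<le> n"
  shows "ext n b s k \<le> ext n b s j"
proof (cases "k = n")
  case True
  then show ?thesis using ext_bounds(1)[of b n s j] assms by (simp add: ext_def)
next
  case False
  then have "(s, j) \<in> triangle n" "(s, k) \<in> triangle n"
    using assms by (auto simp: triangle_def)
  then show ?thesis using assms False unfolding tri_arrays_def by (auto simp: ext_def)
qed

lemma ext_column_mono:
  assumes "b \<in> tri_arrays n" and "1 \<le> s" and "s \<le> s'" and "s' \<le> j" and "j \<le> n"
  shows "ext n b s' j \<le> ext n b s j"
proof (cases "j = n")
  case False
  then have "(s, j) \<in> triangle n" "(s', j) \<in> triangle n"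
    using assms by (auto simp: triangle_def)
  then show ?thesis using assms False unfolding tri_arrays_def by (auto simp: ext_def)
qed (use assms in \<open>simp add: ext_def\<close>)

text \<open>For fixed \<open>i\<close>, the region where \<open>b > i\<close> is bounded by a lattice path descending to the
  diagonal; \<open>(i, k)\<close> records that between the diagonals \<open>k\<close> and \<open>k - 1\<close> it passes a row rather than a column.
  By interlacing of consecutive diagonals the row \<open>s\<close> is unique.\<close>
definition crossings :: "nat \<Rightarrow> (nat \<times> nat \<Rightarrow> int) \<Rightarrow> (nat \<times> nat) set" where
  "crossings n b = {(i, k). 1 \<le> k \<and> (\<exists>s. 1 \<le> s \<and> s + k \<le> n \<and>
     ext n b s (s + k) \<le> int i \<and> int i < ext n b s (s + k - 1))}"

lemma crossings_subset:
  assumes b: "b \<in> tri_arrays n"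
  shows "crossings n b \<subseteq> tri_labels n 0"
proof (rule subrelI)
  fix i k assume "(i, k) \<in> crossings n b"
  then obtain s where s: "1 \<le> k" "1 \<le> s" "s + k \<le> n"
      "ext n b s (s + k) \<le> int i" "int i < ext n b s (s + k - 1)"
    by (auto simp: crossings_def)
  then have "int n - int s \<le> ext n b s (s + k)" "ext n b s (s + k - 1) \<le> int n"
    by (auto intro!: ext_bounds[OF b])
  then show "(i, k) \<in> tri_labels n 0" using s by (simp add: tri_labels_def)
qed

text \<open>Decoding rule: among the rows from \<open>n - i\<close> on, the entries above
  \<open>i\<close> on diagonal \<open>k\<close> form an initial segment of length
  \<open>steps_above\<close>. At \<open>k = i\<close> only the boundary entry, equal to
  \<open>i\<close>, is left. Going down to a smaller \<open>k\<close>, interlacing lengthens the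
  segment by at most one row, and does so exactly at a crossing.\<close>

lemma less_ext_iff_steps_above:
  assumes b: "b \<in> tri_arrays n" and "k \<le> i" and "i < n"
    and "1 \<le> s" and "n \<le> s + i" and "s + k \<le> n"
  shows "int i < ext n b s (s + k) \<longleftrightarrow> s + i < n + steps_above (crossings n b) k i"
  using assms(2,4-6)
proof (induction k arbitrary: s rule: inc_induct)
  case base
  have "steps_above (crossings n b) i i = 0"
    using steps_above_le[OF crossings_subset[OF b], of i i] by simp
  then show ?case using base by (simp add: ext_def)
next
  case (step k)
  define d where "d = steps_above (crossings n b) (Suc k) i"
  have d: "steps_above (crossings n b) k i = d + (if (i, Suc k) \<in> crossings n b then 1 else 0)"
    unfolding d_def by (rule steps_above_Suc[OF crossings_subset[OF b]])
  have IH: "int i < ext n b s (s + Suc k) \<longleftrightarrow> s + i < n + d"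
    if "1 \<le> s" "n \<le> s + i" "s + Suc k \<le> n" for s
    using step.IH[of s] that by (simp add: d_def)
  show ?case
  proof (cases "(i, Suc k) \<in> crossings n b")
    case True
    then obtain s0 where s0: "1 \<le> s0" "s0 + Suc k \<le> n" "ext n b s0 (s0 + Suc k) \<le> int i"
        "int i < ext n b s0 (s0 + k)"
      by (auto simp: crossings_def)
    have low: "n \<le> s0 + i"
      using ext_bounds(1)[OF b, of s0 "s0 + Suc k"] s0 by simp
    have "n + d \<le> s0 + i" using IH[of s0] s0 low by simp
    \<comment> \<open>Otherwise row \<open>s0 - 1\<close> is already at most \<open>i\<close> on
      diagonal \<open>Suc k\<close>, although that entry stands directly above the entry of row
      \<open>s0\<close> on diagonal \<open>k\<close>, which exceeds \<open>i\<close>.\<close>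
    moreover have "s0 + i \<le> n + d"
    proof (rule ccontr)
      assume "\<not> s0 + i \<le> n + d"
      define s1 where "s1 = s0 - 1"
      have s1: "s0 = Suc s1" "1 \<le> s1" "n \<le> s1 + i" "s1 + Suc k \<le> n" "\<not> s1 + i < n + d"
        using \<open>\<not> s0 + i \<le> n + d\<close> assms(3) s0 by (auto simp: s1_def)
      have "ext n b s0 (s0 + k) \<le> ext n b s1 (s0 + k)"
        using s0 s1 by (intro ext_column_mono[OF b]) auto
      then show False using IH[of s1] s0 s1 by simp
    qed
    ultimately have s0_eq: "s0 + i = n + d" by simp
    show ?thesis
    proof (cases "s \<le> s0")
      case True
      have "ext n b s0 (s0 + k) \<le> ext n b s (s0 + k)"
        using s0 step.prems True by (intro ext_column_mono[OF b]) auto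
      also have "\<dots> \<le> ext n b s (s + k)"
        using s0 step.prems True by (intro ext_row_mono[OF b]) auto
      finally show ?thesis using s0 s0_eq True d \<open>(i, Suc k) \<in> crossings n b\<close> by simp
    next
      case False
      have "ext n b s (s + k) \<le> ext n b s0 (s + k)"
        using s0 step.prems False by (intro ext_column_mono[OF b]) auto
      also have "\<dots> \<le> ext n b s0 (s0 + Suc k)"
        using s0 step.prems False by (intro ext_row_mono[OF b]) auto
      finally show ?thesis using s0 s0_eq False d \<open>(i, Suc k) \<in> crossings n b\<close> by simp
    qed
  next
    case False
    show ?thesis
    proof (cases "s + Suc k \<le> n")
      case True
      have "ext n b s (s + Suc k) \<le> ext n b s (s + k)"
        using step.prems True by (intro ext_row_mono[OF b]) auto
      moreover have "\<not> (ext n b s (s + Suc k) \<le> int i \<and> int i < ext n b s (s + k))"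
        using False True step.prems by (auto simp: crossings_def)
      ultimately show ?thesis using IH[of s] step.prems True d False by auto
    next
      case outside: False
      have "d \<le> i - Suc k"
        unfolding d_def by (rule steps_above_le[OF crossings_subset[OF b]])
      then show ?thesis using outside step d False by (simp add: ext_def)
    qed
  qed
qed

text \<open>Complementing replaces a count by \<open>i - k\<close> minus it, so this is the
  non-collision of the complement. For arrays it says that the region of entries above
  \<open>i + 1\<close> lies within the region of entries above \<open>i\<close>.\<close>

definition crossing_sets :: "nat \<Rightarrow> (nat \<times> nat) set set" where
  "crossing_sets n = {X. X \<subseteq> tri_labels n 0 \<and>
     (\<forall>k i. k \<le> i \<longrightarrow> Suc i < n \<longrightarrow> steps_above X k (Suc i) \<le> Suc (steps_above X k i))}"

lemma steps_above_complement:
  assumes "X \<subseteq> tri_labels n 0" and "i < n"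
  shows "steps_above (tri_labels n 0 - X) k i = i - k - steps_above X k i"
proof -
  have "{l. k < l \<and> (i, l) \<in> tri_labels n 0 - X} = {k<..i} - {l. k < l \<and> (i, l) \<in> X}"
    using assms by (auto simp: tri_labels_def)
  moreover have "{l. k < l \<and> (i, l) \<in> X} \<subseteq> {k<..i}"
    using assms by (auto simp: tri_labels_def)
  ultimately show ?thesis
    unfolding steps_above_def by (simp add: card_Diff_subset finite_subset)
qed

lemma complement_in_path_families_iff:
  assumes "X \<subseteq> tri_labels n 0"
  shows "tri_labels n 0 - X \<in> path_families n 0 \<longleftrightarrow> X \<in> crossing_sets n"
proof -
  have "steps_above (tri_labels n 0 - X) k i \<le> steps_above (tri_labels n 0 - X) k (Suc i) \<longleftrightarrow>
      steps_above X k (Suc i) \<le> Suc (steps_above X k i)" if "k \<le> i" "Suc i < n" for k i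
    using that steps_above_le[OF assms, of k i] steps_above_le[OF assms, of k "Suc i"]
    by (auto simp: steps_above_complement[OF assms])
  then show ?thesis
    using assms unfolding path_families_def crossing_sets_def by auto
qed

lemma sum_path_families_eq_crossing_sets:
  fixes w :: "nat \<Rightarrow> nat \<Rightarrow> 'a :: comm_ring_1"
  shows "(\<Sum>E\<in>path_families n 0. \<Prod>(i, l)\<in>tri_labels n 0. if (i, l) \<in> E then 1 else w l i) =
    (\<Sum>X\<in>crossing_sets n. \<Prod>(i, l)\<in>X. w l i)"
proof (rule sum.reindex_bij_witness[of _ "\<lambda>X. tri_labels n 0 - X" "\<lambda>E. tri_labels n 0 - E"])
  fix E assume E: "E \<in> path_families n 0"
  then have sub: "E \<subseteq> tri_labels n 0" by (simp add: path_families_def)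
  then show "tri_labels n 0 - (tri_labels n 0 - E) = E" by auto
  then show "tri_labels n 0 - E \<in> crossing_sets n"
    using E complement_in_path_families_iff[of "tri_labels n 0 - E" n] by simp
  show "(\<Prod>(i, l)\<in>tri_labels n 0 - E. w l i) =
      (\<Prod>(i, l)\<in>tri_labels n 0. if (i, l) \<in> E then 1 else w l i)"
    by (rule prod.mono_neutral_cong_left) auto
next
  fix X assume X: "X \<in> crossing_sets n"
  then have sub: "X \<subseteq> tri_labels n 0" by (simp add: crossing_sets_def)
  then show "tri_labels n 0 - (tri_labels n 0 - X) = X" by auto
  show "tri_labels n 0 - X \<in> path_families n 0"
    using X complement_in_path_families_iff[OF sub] by simp
qed

lemma crossings_in_crossing_sets:
  assumes b: "b \<in> tri_arrays n"
  shows "crossings n b \<in> crossing_sets n"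
proof -
  let ?d = "steps_above (crossings n b)"
  have "?d k (Suc i) \<le> Suc (?d k i)" if ki: "k \<le> i" "Suc i < n" for k i
  proof (rule ccontr)
    assume *: "\<not> ?d k (Suc i) \<le> Suc (?d k i)"
    \<comment> \<open>The first row whose entry on diagonal \<open>k\<close> is at most
      \<open>i\<close>.\<close>
    define s where "s = n + ?d k i - i"
    have "?d k i \<le> i - k" by (rule steps_above_le[OF crossings_subset[OF b]])
    then have s: "1 \<le> s" "s + i = n + ?d k i" "s + k \<le> n"
      using ki by (auto simp: s_def)
    have "int i < ext n b s (s + k) \<longleftrightarrow> s + i < n + ?d k i"
      using s ki by (intro less_ext_iff_steps_above[OF b]) auto
    moreover have "int (Suc i) < ext n b s (s + k) \<longleftrightarrow> s + Suc i < n + ?d k (Suc i)"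
      using s ki by (intro less_ext_iff_steps_above[OF b]) auto
    ultimately show False using * s by simp
  qed
  then show ?thesis using crossings_subset[OF b] by (simp add: crossing_sets_def)
qed

section \<open>Recovering an array from its crossings\<close>

lemma inj_on_crossings: "inj_on (crossings n) (tri_arrays n)"
proof (rule inj_onI)
  fix b b' assume b: "b \<in> tri_arrays n" and b': "b' \<in> tri_arrays n"
    and eq: "crossings n b = crossings n b'"
  have "b (s, j) = b' (s, j)" if tri: "(s, j) \<in> triangle n" for s j
  proof -
    have j: "1 \<le> s" "s \<le> j" "j < n" using tri by (auto simp: triangle_def)
    have "int i < ext n b s j \<longleftrightarrow> int i < ext n b' s j" if i: "n \<le> s + i" "i < n" for i
      using less_ext_iff_steps_above[OF b, of "j - s" i s]
        less_ext_iff_steps_above[OF b', of "j - s" i s] eq i j by auto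
    moreover have bounds: "int n - int s \<le> b (s, j) \<and> b (s, j) \<le> int n"
        "int n - int s \<le> b' (s, j) \<and> b' (s, j) \<le> int n"
      using tri b b' by (auto simp: tri_arrays_def)
    moreover have "ext n b s j = b (s, j)" "ext n b' s j = b' (s, j)"
      using j by (auto simp: ext_def)
    ultimately have less_iff: "int i < b (s, j) \<longleftrightarrow> int i < b' (s, j)" if "n \<le> s + i" "i < n" for i
      using that by simp
    have nonneg: "0 \<le> b (s, j)" "0 \<le> b' (s, j)" using bounds j by auto
    \<comment> \<open>If the two values differed, the smaller one would be a threshold
      \<open>i\<close> separating them.\<close>
    show ?thesis
      using less_iff[of "nat (b (s, j))"] less_iff[of "nat (b' (s, j))"] bounds nonneg j by linarith
  qed
  moreover have "b \<in> extensional (triangle n)" "b' \<in> extensional (triangle n)"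
    using b b' by (auto simp: tri_arrays_def PiE_def)
  ultimately show "b = b'"
    by (intro extensionalityI[of b "triangle n" b']) auto
qed

lemma crossings_surj:
  assumes X: "X \<in> crossing_sets n"
  shows "X \<in> crossings n ` tri_arrays n"
proof -
  have sub: "X \<subseteq> tri_labels n 0" using X by (simp add: crossing_sets_def)
  define P where "P s k i \<longleftrightarrow> n + steps_above X k i \<le> s + i" for s k i
  \<comment> \<open>The entry at distance \<open>k\<close> from the diagonal in row \<open>s\<close>, read off from \<open>less_ext_iff_steps_above\<close>.\<close>
  define val where "val s k = (LEAST i. P s k i)" for s k
  have "(n, l) \<notin> X" for l using sub by (auto simp: tri_labels_def)
  then have "steps_above X k n = 0" for k by (simp add: steps_above_def)
  then have P_n: "P s k n" for s k by (simp add: P_def)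
  have P_val: "P s k (val s k)" for s k unfolding val_def by (rule LeastI[of "P s k", OF P_n])
  have val_le: "P s k i \<Longrightarrow> val s k \<le> i" for s k i unfolding val_def by (rule Least_le)
  have val_bounds: "n \<le> s + val s k" "val s k \<le> n" for s k
    using P_val[of s k] val_le[OF P_n] by (auto simp: P_def)
  \<comment> \<open>The defining inequality of \<open>crossing_sets\<close> enters here: per unit of
    \<open>i\<close> the count grows by at most one, which the growth of \<open>s + i\<close>
    absorbs.\<close>
  have P_up: "P s k i" if "P s k i'" "i' \<le> i" "i < n" "s + k \<le> n" for s k i i'
    using that(2,1,3)
  proof (induction rule: dec_induct)
    case (step m)
    then have "P s k m" by simp
    then have "k \<le> m" using that(4) by (simp add: P_def)
    then have "steps_above X k (Suc m) \<le> Suc (steps_above X k m)"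
      using X step.prems unfolding crossing_sets_def by auto
    then show ?case using \<open>P s k m\<close> by (simp add: P_def)
  qed
  have val_le_iff: "val s k \<le> i \<longleftrightarrow> P s k i" if "i < n" "s + k \<le> n" for s k i
    using P_up[OF P_val] val_le that by blast
  \<comment> \<open>The first bound makes columns decrease, since there the diagonal index falls by
    as much as the row index rises; the second makes rows decrease.\<close>
  have steps_mono: "steps_above X k' i \<le> steps_above X k i + (k - k')"
    "k' \<le> k \<Longrightarrow> steps_above X k i \<le> steps_above X k' i" for k k' i
  proof -
    have "{l. k' < l \<and> (i, l) \<in> X} \<subseteq> {l. k < l \<and> (i, l) \<in> X} \<union> {k'<..k}" by auto
    then have "card {l. k' < l \<and> (i, l) \<in> X} \<le> card ({l. k < l \<and> (i, l) \<in> X} \<union> {k'<..k})"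
      using finite_steps[OF sub] by (intro card_mono) auto
    also have "\<dots> \<le> card {l. k < l \<and> (i, l) \<in> X} + card {k'<..k}" by (rule card_Un_le)
    finally show "steps_above X k' i \<le> steps_above X k i + (k - k')"
      by (simp add: steps_above_def)
    show "steps_above X k i \<le> steps_above X k' i" if "k' \<le> k"
      unfolding steps_above_def using that finite_steps[OF sub] by (intro card_mono) auto
  qed
  define b where "b = (\<lambda>(s, j)\<in>triangle n. int (val s (j - s)))"
  have b_eq: "b (s, j) = int (val s (j - s))" if "(s, j) \<in> triangle n" for s j
    using that by (simp add: b_def)
  have "b \<in> tri_arrays n"
    unfolding tri_arrays_def
  proof (intro CollectI conjI allI impI)
    show "b \<in> triangle n \<rightarrow>\<^sub>E UNIV" by (auto simp: b_def)
  next
    fix s j assume tri: "(s, j) \<in> triangle n"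
    then show "int n - int s \<le> b (s, j)" "b (s, j) \<le> int n"
      using val_bounds[of s "j - s"] by (auto simp: b_eq)
  next
    fix s j k assume tri: "(s, j) \<in> triangle n" "(s, k) \<in> triangle n" "j \<le> k"
    then have "P s (k - s) (val s (j - s))"
      using P_val[of s "j - s"] steps_mono(2)[OF diff_le_mono[OF tri(3)], of s "val s (j - s)"]
      by (simp add: P_def)
    then show "b (s, k) \<le> b (s, j)" using tri val_le by (simp add: b_eq)
  next
    fix s s' j assume tri: "(s, j) \<in> triangle n" "(s', j) \<in> triangle n" "s \<le> s'"
    then have "j - s - (j - s') = s' - s" by (auto simp: triangle_def)
    then have "P s' (j - s') (val s (j - s))"
      using P_val[of s "j - s"] steps_mono(1)[of "j - s'" "val s (j - s)" "j - s"] tri(3)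
      unfolding P_def by linarith
    then show "b (s', j) \<le> b (s, j)" using tri val_le by (simp add: b_eq)
  qed
  moreover have ext_b: "ext n b s (s + k) = int (val s k)" if "1 \<le> s" "s + k \<le> n" for s k
  proof (cases "s + k = n")
    case True
    have "steps_above X k k = 0" using steps_above_le[OF sub, of k k] by simp
    then have "P s k k" using True by (simp add: P_def)
    then show ?thesis using val_le[of s k k] val_bounds[of s k] True that by (simp add: ext_def)
  next
    case False
    then have "(s, s + k) \<in> triangle n" using that by (auto simp: triangle_def)
    then show ?thesis using that False by (simp add: ext_def b_eq)
  qed
  have "(i, k) \<in> crossings n b \<longleftrightarrow> (i, k) \<in> X" for i k
  proof (cases "1 \<le> k \<and> i < n")
    case True
    then obtain k' where k': "k = Suc k'" by (cases k) auto
    have d: "steps_above X k' i = steps_above X k i + (if (i, k) \<in> X then 1 else 0)"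
      unfolding k' by (rule steps_above_Suc[OF sub])
    have "(i, k) \<in> crossings n b \<longleftrightarrow>
        (\<exists>s. 1 \<le> s \<and> s + k \<le> n \<and> val s k \<le> i \<and> i < val s k')"
      using k' by (auto simp: crossings_def ext_b add_Suc_right[symmetric] simp del: add_Suc_right)
    also have "\<dots> \<longleftrightarrow> (\<exists>s. 1 \<le> s \<and> s + k \<le> n \<and>
        n + steps_above X k i \<le> s + i \<and> s + i < n + steps_above X k' i)"
      using val_le_iff True k' by (intro ex_cong1) (auto simp: P_def not_le[symmetric])
    \<comment> \<open>The last two conditions confine \<open>s\<close> to an interval whose length
      is the increment of the count, which is 1 exactly if \<open>(i, k)\<close> lies in
      \<open>X\<close>.\<close>
    also have "\<dots> \<longleftrightarrow> (i, k) \<in> X"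
    proof
      assume ik: "(i, k) \<in> X"
      then have "k \<le> i" using sub by (auto simp: tri_labels_def)
      then show "\<exists>s. 1 \<le> s \<and> s + k \<le> n \<and>
          n + steps_above X k i \<le> s + i \<and> s + i < n + steps_above X k' i"
        using steps_above_le[OF sub, of k i] True d ik
        by (intro exI[of _ "n + steps_above X k i - i"]) auto
    qed (use d in \<open>auto split: if_splits\<close>)
    finally show ?thesis .
  next
    case False
    have "crossings n b \<subseteq> tri_labels n 0" by (rule crossings_subset[OF \<open>b \<in> tri_arrays n\<close>])
    then show ?thesis using sub False by (auto simp: tri_labels_def)
  qed
  then have "crossings n b = X" by auto
  ultimately show ?thesis by blast
qed

lemma bij_betw_crossings: "bij_betw (crossings n) (tri_arrays n) (crossing_sets n)"
  unfolding bij_betw_def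
  using inj_on_crossings crossings_surj crossings_in_crossing_sets by auto

text \<open>The drop from diagonal \<open>r - 1\<close> to diagonal \<open>r\<close> in a row counts
  the thresholds \<open>i\<close> crossed there. Interlacing makes the rows contribute disjoint
  sets, so the first sum counts crossings with label \<open>r\<close>. The indicator for row
  \<open>s\<close> tests label \<open>i\<close> of particle \<open>i = n - s\<close>, the first
  label of that particle.\<close>

lemma U_stat_eq_card:
  assumes b: "b \<in> tri_arrays n" and r: "1 \<le> r" "r \<le> n"
  shows "U_stat n r b = int (card {i. (i, min r i) \<in> crossings n b})"
proof -
  let ?X = "crossings n b"
  define A where "A s = {i. ext n b s (s + r) \<le> int i \<and> int i < ext n b s (s + r - 1)}" for s
  have label_le: "1 \<le> l" "l \<le> i" "i < n" if "(i, l) \<in> ?X" for i l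
    using crossings_subset[OF b] that by (auto simp: tri_labels_def)
  have A: "finite (A s)" "int (card (A s)) = ext n b s (s + r - 1) - ext n b s (s + r)"
    if "s \<in> {1..n - r}" for s
  proof -
    have "ext n b s (s + r) \<le> ext n b s (s + r - 1)" "int n - int s \<le> ext n b s (s + r)"
      using that r by (auto intro!: ext_row_mono[OF b] ext_bounds[OF b])
    moreover have "A s = {nat (ext n b s (s + r))..<nat (ext n b s (s + r - 1))}"
      unfolding A_def using calculation that by auto
    ultimately show "finite (A s)" "int (card (A s)) = ext n b s (s + r - 1) - ext n b s (s + r)"
      using that by auto
  qed
  have disj: "A s \<inter> A s' = {}" if "s \<in> {1..n - r}" "s' \<in> {1..n - r}" "s < s'" for s s'
  proof -
    have "ext n b s' (s' + r - 1) \<le> ext n b s (s' + r - 1)"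
      using that r by (intro ext_column_mono[OF b]) auto
    also have "\<dots> \<le> ext n b s (s + r)"
      using that r by (intro ext_row_mono[OF b]) auto
    finally show ?thesis by (auto simp: A_def)
  qed
  have "(\<Sum>s = 1..n - r. ext n b s (s + r - 1) - ext n b s (s + r)) = int (\<Sum>s = 1..n - r. card (A s))"
    by (simp add: A(2))
  also have "(\<Sum>s = 1..n - r. card (A s)) = card (\<Union>s\<in>{1..n - r}. A s)"
  proof (rule card_UN_disjoint[symmetric])
    show "\<forall>i\<in>{1..n - r}. \<forall>j\<in>{1..n - r}. i \<noteq> j \<longrightarrow> A i \<inter> A j = {}"
    proof (intro ballI impI)
      fix s s' assume "s \<in> {1..n - r}" "s' \<in> {1..n - r}" "s \<noteq> s'"
      then show "A s \<inter> A s' = {}"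
        using disj[of s s'] disj[of s' s] by (cases "s < s'") (simp_all add: Int_commute)
    qed
  qed (use A in auto)
  also have "(\<Union>s\<in>{1..n - r}. A s) = {i. (i, r) \<in> ?X}"
  proof -
    have "s \<in> {1..n - r} \<longleftrightarrow> 1 \<le> s \<and> s + r \<le> n" for s using r by auto
    then show ?thesis
      unfolding set_eq_iff UN_iff A_def crossings_def mem_Collect_eq case_prod_conv Bex_def
      using r(1) by (simp only: conj_assoc simp_thms)
  qed
  finally have first: "(\<Sum>s = 1..n - r. ext n b s (s + r - 1) - ext n b s (s + r)) =
      int (card {i. (i, r) \<in> ?X})" .
  have diag: "(i, i) \<in> ?X \<longleftrightarrow> int i < ext n b (n - i) (n - 1)" if "1 \<le> i" "i < r" for i
  proof
    assume "(i, i) \<in> ?X"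
    then obtain s where s: "1 \<le> s" "s + i \<le> n" "ext n b s (s + i) \<le> int i" "int i < ext n b s (s + i - 1)"
      by (auto simp: crossings_def)
    have "int n - int s \<le> ext n b s (s + i)" using s by (intro ext_bounds[OF b]) auto
    then have "s = n - i" using s by simp
    then show "int i < ext n b (n - i) (n - 1)" using s by simp
  next
    assume "int i < ext n b (n - i) (n - 1)"
    then show "(i, i) \<in> ?X"
      using that r unfolding crossings_def mem_Collect_eq case_prod_conv
      by (intro conjI exI[of _ "n - i"]) (simp_all add: ext_def)
  qed
  have "(\<Sum>s = n - r + 1..n - 1. if ext n b s (n - 1) > int n - int s then 1 else 0) =
      (\<Sum>i = 1..<r. if (i, i) \<in> ?X then 1 else 0 :: int)"
    by (rule sum.reindex_bij_witness[of _ "\<lambda>i. n - i" "\<lambda>s. n - s"])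
       (use r diag in \<open>auto simp: of_nat_diff\<close>)
  also have "\<dots> = int (card {i \<in> {1..<r}. (i, i) \<in> ?X})"
    by (simp add: sum.If_cases Int_def)
  also have "{i \<in> {1..<r}. (i, i) \<in> ?X} = {i. i < r \<and> (i, i) \<in> ?X}"
  proof -
    have "1 \<le> i" if "(i, i) \<in> ?X" for i by (rule label_le(1)[OF that])
    then show ?thesis by auto
  qed
  finally have second: "(\<Sum>s = n - r + 1..n - 1. if ext n b s (n - 1) > int n - int s then 1 else 0) =
      int (card {i. i < r \<and> (i, i) \<in> ?X})" .
  have "{i. (i, min r i) \<in> ?X} = {i. (i, r) \<in> ?X} \<union> {i. i < r \<and> (i, i) \<in> ?X}"
  proof (rule Set.set_eqI)
    fix i
    show "i \<in> {i. (i, min r i) \<in> ?X} \<longleftrightarrow> i \<in> {i. (i, r) \<in> ?X} \<union> {i. i < r \<and> (i, i) \<in> ?X}"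
      using label_le[of i r] by (cases "r \<le> i") (auto simp: min_def)
  qed
  moreover have "finite {i. (i, r) \<in> ?X}"
    by (rule finite_subset[of _ "{..<n}"]) (auto intro: label_le(3))
  moreover have "{i. (i, r) \<in> ?X} \<inter> {i. i < r \<and> (i, i) \<in> ?X} = {}"
  proof -
    have "\<not> i < r" if "(i, r) \<in> ?X" for i using label_le(2)[OF that] by simp
    then show ?thesis by blast
  qed
  ultimately have "card {i. (i, min r i) \<in> ?X} =
      card {i. (i, r) \<in> ?X} + card {i. i < r \<and> (i, i) \<in> ?X}"
    by (simp add: card_Un_disjoint)
  then show ?thesis unfolding U_stat_def first second by simp
qed

lemma prod_if_eq_power:
  fixes a :: "'a :: comm_monoid_mult"
  assumes "finite X"
  shows "(\<Prod>(i, l)\<in>X. if l = f i then a else 1) = a ^ card {i. (i, f i) \<in> X}"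
proof -
  have "(\<Prod>(i, l)\<in>X. if l = f i then a else 1) = (\<Prod>x\<in>{x \<in> X. snd x = f (fst x)}. a)"
    by (rule prod.mono_neutral_cong_right) (use assms in \<open>auto split: prod.splits\<close>)
  also have "\<dots> = (\<Prod>i\<in>{i. (i, f i) \<in> X}. a)"
    by (rule prod.reindex_bij_witness[of _ "\<lambda>i. (i, f i)" fst]) auto
  finally show ?thesis by simp
qed

theorem theorem1p4:
  fixes n N r :: nat and t u :: "'a :: comm_ring_1"
  assumes "n \<ge> 1" and "even N" and "N \<ge> n - 1" and "2 \<le> r" and "r \<le> n"
  shows "(\<Sum>b \<in> tri_arrays n. t ^ nat (U_stat n 1 b) * u ^ nat (U_stat n r b)) =
    pfaffian (four_block_mat
      (0\<^sub>m n n)                                  (J_mat n * B_mat n N t u)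
      (- (transpose_mat (B_mat n N t u) * J_mat n)) (S_bar_mat (n + N)))"
proof -
  have "t ^ nat (U_stat n 1 b) * u ^ nat (U_stat n r b) =
      (\<Prod>(i, l)\<in>crossings n b. label_weight r t u l i)" if b: "b \<in> tri_arrays n" for b
  proof -
    let ?X = "crossings n b"
    have sub: "?X \<subseteq> tri_labels n 0" by (rule crossings_subset[OF b])
    have fin: "finite ?X" by (rule finite_subset[OF sub]) simp
    \<comment> \<open>Particle 0, where \<open>min 1 0\<close> is 0 instead of 1, has no labels at
      all.\<close>
    have "(i, min 1 i) \<in> ?X \<longleftrightarrow> (i, 1) \<in> ?X" for i
      using sub by (cases i) (auto simp: tri_labels_def)
    then have "nat (U_stat n 1 b) = card {i. (i, 1) \<in> ?X}"
      using U_stat_eq_card[OF b, of 1] assms by simp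
    moreover have "nat (U_stat n r b) = card {i. (i, min r i) \<in> ?X}"
      using U_stat_eq_card[OF b, of r] assms by simp
    ultimately show ?thesis
      using prod_if_eq_power[OF fin, of "\<lambda>_. 1" t] prod_if_eq_power[OF fin, of "min r" u]
      by (simp add: label_weight_def split_def prod.distrib)
  qed
  then have "(\<Sum>b \<in> tri_arrays n. t ^ nat (U_stat n 1 b) * u ^ nat (U_stat n r b)) =
      (\<Sum>b \<in> tri_arrays n. \<Prod>(i, l)\<in>crossings n b. label_weight r t u l i)"
    by (rule sum.cong[OF refl])
  also have "\<dots> = (\<Sum>X\<in>crossing_sets n. \<Prod>(i, l)\<in>X. label_weight r t u l i)"
    by (rule sum.reindex_bij_betw[OF bij_betw_crossings])
  also have "\<dots> = pfaffian (four_block_mat (0\<^sub>m n n) (J_mat n * B_mat n N t u)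
      (- (transpose_mat (B_mat n N t u) * J_mat n)) (S_bar_mat (n + N)))"
    unfolding pfaffian_eq_sum_path_families[OF assms(2-4)]
    by (rule sum_path_families_eq_crossing_sets[symmetric])
  finally show ?thesis .
qed

end
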